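(* Let $\mathcal B\neq\{0\}$ be a complex reflexive Banach space and let $(S(t))_{t\ge0}$ be a strongly continuous semigroup of bounded operators on $\mathcal B$ with $S(0)=I$. Let $\omega\in\mathbb R$, $p>1$, $\frac1p+\frac1q=1$, and suppose that $K_{\omega,p}$ is finite; put $\hat r_p(\omega):=1/K_{\omega,p}$. Let $m:[0,+\infty[\,\to\,]0,+\infty[$ be continuous with $\|S(t)\|\le m(t)$ for all $t\ge0$. Let $\Phi,\Psi\in C^1([0,+\infty[)$ be real-valued functions with $\Phi(0)=\Psi(0)=0$ and $\Phi(t)>0$, $\Psi(t)>0$ for $t>0$. Then for any $\epsilon_1,\epsilon_2\in\{-,+\}$ and any $t>0$ for which the denominator below is nonzero, $$\|S(t)\|_{\mathcal L(\mathcal B)}\le e^{\omega t}\,\frac{\left\|\left(\hat r_p(\omega)^p\Phi^p-|\Phi'|^p\right)_-^{1/p}m\right\|_{e^{\omega\cdot}L^p(]0,t[)}\ \left\|\left(\hat r_p(\omega)^q\Psi^q-|\Psi'|^q\right)_-^{1/q}m\right\|_{e^{\omega\cdot}L^q(]0,t[)}}{\displaystyle\int_0^t\left(\hat r_p(\omega)^p\Phi^p-|\Phi'|^p\right)_{\epsilon_1}^{1/p}\left(\hat r_p(\omega)^q(\iota_t\Psi)^q-|(\iota_t\Psi)'|^q\right)_{\epsilon_2}^{1/q}ds}.$$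
   Context: Here $1<p<\infty$. For $x\in\mathbb R$, $x_+=\max(x,0)$ and $x_-=\max(-x,0)$. For $t>0$, $\iota_t$ is the reflection in $t/2$: $(\iota_tu)(s)=u(t-s)$. For $1<r<\infty$ and an interval $I$, $\|f\|_{e^{\omega\cdot}L^r(I)}:=\|e^{-\omega\cdot}f(\cdot)\|_{L^r(I)}$. The space $L^p_\omega(\mathbb R_+;\mathcal B)=e^{\omega\cdot}L^p(\mathbb R_+;\mathcal B)$ consists of the measurable $u:\mathbb R_+\to\mathcal B$ with norm $\left(\int_0^\infty e^{-p\omega t}\|u(t)\|_{\mathcal B}^p\,dt\right)^{1/p}<\infty$. For such $u$ set $$(\mathcal K^+u)(t)=\int_0^tS(t-s)u(s)\,ds,\qquad t\ge0,$$ and define $K_{\omega,p}:=\|\mathcal K^+\|_{\mathcal L(L^p_\omega(\mathbb R_+;\mathcal B))}$; finiteness of $K_{\omega,p}$ means that $\mathcal K^+$ is a bounded operator on $L^p_\omega(\mathbb R_+;\mathcal B)$. *)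

theory Defs
  imports "HOL-Analysis.Analysis"
begin

section \<open>Complex Banach spaces and bounded complex-linear maps\<close>

class complex_normed_vector = real_normed_vector +
  fixes scaleC :: "complex \<Rightarrow> 'a \<Rightarrow> 'a"  (infixr "*\<^sub>C" 75)
  assumes scaleC_add_right: "a *\<^sub>C (x + y) = a *\<^sub>C x + a *\<^sub>C y"
    and scaleC_add_left: "(a + b) *\<^sub>C x = a *\<^sub>C x + b *\<^sub>C x"
    and scaleC_scaleC: "a *\<^sub>C (b *\<^sub>C x) = (a * b) *\<^sub>C x"
    and scaleR_scaleC: "r *\<^sub>R x = complex_of_real r *\<^sub>C x"
    and norm_scaleC: "norm (a *\<^sub>C x) = cmod a * norm x"

class complex_banach = complex_normed_vector + banach

instantiation complex :: complex_banach
begin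

definition scaleC_complex :: "complex \<Rightarrow> complex \<Rightarrow> complex" where
  "scaleC_complex a x = a * x"

instance
  by standard (simp_all add: scaleC_complex_def algebra_simps scaleR_conv_of_real norm_mult)

end

definition bounded_clinear ::
  "('a::complex_normed_vector \<Rightarrow> 'b::complex_normed_vector) \<Rightarrow> bool" where
  "bounded_clinear f \<longleftrightarrow> bounded_linear f \<and> (\<forall>c x. f (c *\<^sub>C x) = c *\<^sub>C f x)"

text \<open>The dual space is the set of all \<open>f\<close> with \<open>bounded_clinear f\<close>, normed by \<^const>\<open>onorm\<close>;
  an element of the bidual is a function whose values outside that set are irrelevant.\<close>

definition bidual_functional ::
  "(('a::complex_normed_vector \<Rightarrow> complex) \<Rightarrow> complex) \<Rightarrow> bool" where
  "bidual_functional F \<longleftrightarrow>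
     (\<forall>f g. bounded_clinear f \<longrightarrow> bounded_clinear g \<longrightarrow> F (\<lambda>x. f x + g x) = F f + F g) \<and>
     (\<forall>c f. bounded_clinear f \<longrightarrow> F (\<lambda>x. c * f x) = c * F f) \<and>
     (\<exists>M. \<forall>f. bounded_clinear f \<longrightarrow> cmod (F f) \<le> M * onorm f)"

text \<open>Reflexivity: the canonical embedding into the bidual is onto.\<close>

definition reflexive_space :: "'a::complex_normed_vector itself \<Rightarrow> bool" where
  "reflexive_space _ \<longleftrightarrow>
     (\<forall>F. bidual_functional F \<longrightarrow> (\<exists>x::'a. \<forall>f. bounded_clinear f \<longrightarrow> F f = f x))"

section \<open>Strongly continuous semigroups\<close>

text \<open>The values \<open>S t\<close> for \<open>t < 0\<close> are unconstrained and never used.\<close>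

definition C0_semigroup :: "(real \<Rightarrow> 'a::complex_banach \<Rightarrow> 'a) \<Rightarrow> bool" where
  "C0_semigroup S \<longleftrightarrow>
     (\<forall>t\<ge>0. bounded_clinear (S t)) \<and>
     S 0 = id \<and>
     (\<forall>s\<ge>0. \<forall>t\<ge>0. S (s + t) = S s \<circ> S t) \<and>
     (\<forall>x. continuous_on {0..} (\<lambda>t. S t x))"

section \<open>Weighted Lebesgue spaces\<close>

text \<open>Bochner (strong) measurability. Borel measurability alone is too weak here, since the
  Banach space need not be separable.\<close>

definition strongly_measurable ::
  "'b measure \<Rightarrow> ('b \<Rightarrow> 'a::real_normed_vector) \<Rightarrow> bool" where
  "strongly_measurable M f \<longleftrightarrow>
     (\<exists>s. (\<forall>i::nat. simple_function M (s i)) \<and> (AE x in M. (\<lambda>i. s i x) \<longlonglongrightarrow> f x))"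

definition weighted_norm ::
  "real \<Rightarrow> real \<Rightarrow> real set \<Rightarrow> (real \<Rightarrow> 'a::real_normed_vector) \<Rightarrow> real" where
  "weighted_norm \<omega> r I f =
     (LINT s:I|lebesgue. (exp (- \<omega> * s) * norm (f s)) powr r) powr (1 / r)"

text \<open>\<open>weighted_Lp \<omega> r\<close> is the space of functions on the half-line \<open>[0, \<infinity>)\<close>; values at negative
  arguments are irrelevant, and functions equal almost everywhere are not identified.\<close>

definition weighted_Lp :: "real \<Rightarrow> real \<Rightarrow> (real \<Rightarrow> 'a::real_normed_vector) set" where
  "weighted_Lp \<omega> r =
     {u. strongly_measurable (lebesgue_on {0..}) u \<and>
         set_integrable lebesgue {0..} (\<lambda>s. (exp (- \<omega> * s) * norm (u s)) powr r)}"

section \<open>The convolution operator\<close>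

text \<open>The library's Bochner integral is restricted to second countable spaces, so the
  Henstock--Kurzweil integral is used. For \<open>u\<close> in \<open>weighted_Lp \<omega> p\<close> with \<open>p > 1\<close> the integrand is
  Bochner integrable on \<open>[0, t]\<close>, and for such functions the two integrals coincide.\<close>

definition conv_op ::
  "(real \<Rightarrow> 'a::complex_banach \<Rightarrow> 'a) \<Rightarrow> (real \<Rightarrow> 'a) \<Rightarrow> real \<Rightarrow> 'a" where
  "conv_op S u t = integral {0..t} (\<lambda>s. S (t - s) (u s))"

definition conv_bounded ::
  "(real \<Rightarrow> 'a::complex_banach \<Rightarrow> 'a) \<Rightarrow> real \<Rightarrow> real \<Rightarrow> bool" where
  "conv_bounded S \<omega> p \<longleftrightarrow>
     (\<forall>u\<in>weighted_Lp \<omega> p. conv_op S u \<in> weighted_Lp \<omega> p) \<and>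
     (\<exists>C. \<forall>u\<in>weighted_Lp \<omega> p.
        weighted_norm \<omega> p {0..} (conv_op S u) \<le> C * weighted_norm \<omega> p {0..} u)"

text \<open>Operator norm in the style of \<^const>\<open>onorm\<close>; meaningful when \<open>conv_bounded S \<omega> p\<close> holds.\<close>

definition conv_norm ::
  "(real \<Rightarrow> 'a::complex_banach \<Rightarrow> 'a) \<Rightarrow> real \<Rightarrow> real \<Rightarrow> real" where
  "conv_norm S \<omega> p =
     (SUP u\<in>weighted_Lp \<omega> p. weighted_norm \<omega> p {0..} (conv_op S u) / weighted_norm \<omega> p {0..} u)"

definition r_hat :: "(real \<Rightarrow> 'a::complex_banach \<Rightarrow> 'a) \<Rightarrow> real \<Rightarrow> real \<Rightarrow> real" where
  "r_hat S \<omega> p = 1 / conv_norm S \<omega> p"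

section \<open>Scalar functions\<close>

definition C1_nonneg :: "(real \<Rightarrow> real) \<Rightarrow> bool" where
  "C1_nonneg f \<longleftrightarrow>
     (\<exists>f'. continuous_on {0..} f' \<and>
           (\<forall>t\<ge>0. (f has_real_derivative f' t) (at t within {0..})))"

definition pos_part :: "real \<Rightarrow> real" where
  "pos_part x = max x 0"

definition neg_part :: "real \<Rightarrow> real" where
  "neg_part x = max (- x) 0"

definition reflect :: "real \<Rightarrow> (real \<Rightarrow> real) \<Rightarrow> real \<Rightarrow> real" where
  "reflect t u s = u (t - s)"

text \<open>\<open>defect r p f s\<close> is \<open>r\<^sup>p f(s)\<^sup>p - |f'(s)|\<^sup>p\<close>. It is only evaluated at interior points of the domain
  of \<open>f\<close>, where the two-sided derivative \<^const>\<open>deriv\<close> exists.\<close>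

definition defect :: "real \<Rightarrow> real \<Rightarrow> (real \<Rightarrow> real) \<Rightarrow> real \<Rightarrow> real" where
  "defect r p f s = r powr p * f s powr p - \<bar>deriv f s\<bar> powr p"

end

theory Submission
  imports Defs
begin

text \<open>The function \<open>\<Phi> S x\<close> is the convolution of \<open>S\<close> with \<open>\<Phi>' S x\<close>, so boundedness of the
  convolution operator gives \<open>\<parallel>\<Phi> S x\<parallel> \<le> K \<parallel>\<Phi>' S x\<parallel>\<close> in the weighted \<open>L\<^sup>p\<close> norm on
  \<open>(0, t)\<close>; splitting \<open>r\<^sup>p \<Phi>\<^sup>p - \<bar>\<Phi>'\<bar>\<^sup>p\<close> into its positive and negative parts bounds
  \<open>\<parallel>S x\<parallel>\<close>, weighted by either part, by the negative part against \<open>m \<parallel>x\<parallel>\<close>. Dually, for a norming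
  functional \<open>y\<close> the same holds in \<open>L\<^sup>q\<close> for \<open>h(s) = \<parallel>y \<circ> S(s)\<parallel>\<close> and \<open>\<Psi>\<close>. The two bounds
  are combined by Hoelder's inequality, since \<open>\<parallel>S(t) x\<parallel> \<le> h(t - s) \<parallel>S(s) x\<parallel>\<close> for all
  \<open>0 < s < t\<close>.

  For the dual bound, \<open>h\<close> is a supremum of continuous functions, hence (Lindelof) the pointwise limit of \<open>y (S(s) u\<^sub>n(s))\<close> with continuous \<open>u\<^sub>n\<close> in the
  unit ball, and the \<open>u\<^sub>n\<close> serve as test functions in the duality argument.\<close>

section \<open>Hoelder's inequality\<close>

lemma conjugate_exponent_gt_1:
  fixes p q :: real
  assumes "p > 1" "1 / p + 1 / q = 1"
  shows "q > 1"
proof -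
  have "1 / q = 1 - 1 / p" using assms by simp
  moreover have "1 / p < 1" "1 / p > 0" using assms by auto
  ultimately have "1 / q > 0" "1 / q < 1" by linarith+
  then show ?thesis by (simp add: divide_simps split: if_splits)
qed

text \<open>Young's inequality applied to f / a and g / b with a, b > 0; taking the two norms for a
  and b makes the bound sharp. If one of the norms vanishes, the product is zero almost
  everywhere.\<close>

lemma Holder_inequality:
  fixes f g :: "'b \<Rightarrow> real"
  assumes pq: "p > 1" "1 / p + 1 / q = 1"
    and f: "\<And>x. x \<in> space M \<Longrightarrow> f x \<ge> 0" and g: "\<And>x. x \<in> space M \<Longrightarrow> g x \<ge> 0"
    and [measurable]: "f \<in> borel_measurable M" "g \<in> borel_measurable M"
    and fp: "integrable M (\<lambda>x. f x powr p)" and gq: "integrable M (\<lambda>x. g x powr q)"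
  shows "integrable M (\<lambda>x. f x * g x)"
    and "(\<integral>x. f x * g x \<partial>M)
      \<le> (\<integral>x. f x powr p \<partial>M) powr (1 / p) * (\<integral>x. g x powr q \<partial>M) powr (1 / q)"
proof -
  define A where "A = (\<integral>x. f x powr p \<partial>M)"
  define B where "B = (\<integral>x. g x powr q \<partial>M)"
  have q: "q > 1" by (rule conjugate_exponent_gt_1[OF pq])
  have A0: "A \<ge> 0" and B0: "B \<ge> 0" unfolding A_def B_def by (auto intro!: integral_nonneg_AE)
  show fg: "integrable M (\<lambda>x. f x * g x)"
  proof (rule Bochner_Integration.integrable_bound)
    show "integrable M (\<lambda>x. f x powr p / p + g x powr q / q)" using fp gq by auto
    show "AE x in M. norm (f x * g x) \<le> norm (f x powr p / p + g x powr q / q)"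
      using Youngs_inequality[OF pq(1) q pq(2) f g] f g pq q by auto
  qed measurable
  \<comment> \<open>The scales \<open>a\<close> and \<open>b\<close> stay free here, so that nothing
    is divided by a norm that might be zero. With the norms inserted, both quotients become 1 and
    the factor 1 / p + 1 / q = 1 remains.\<close>
  have young: "(\<integral>x. f x * g x \<partial>M) \<le> A / (a powr p) / p * (a * b) + B / (b powr q) / q * (a * b)"
    if a: "a > 0" and b: "b > 0" for a b
  proof -
    have "(\<integral>x. f x * g x \<partial>M)
        \<le> (\<integral>x. f x powr p * (a * b / (a powr p * p)) + g x powr q * (a * b / (b powr q * q)) \<partial>M)"
    proof (rule integral_mono)
      fix x assume x: "x \<in> space M"
      have "f x / a * (g x / b) \<le> (f x / a) powr p / p + (g x / b) powr q / q"
        by (rule Youngs_inequality) (use pq q f[OF x] g[OF x] a b in auto)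
      then have "f x / a * (g x / b) * (a * b)
          \<le> ((f x / a) powr p / p + (g x / b) powr q / q) * (a * b)"
        using a b by (intro mult_right_mono) auto
      then show "f x * g x
          \<le> f x powr p * (a * b / (a powr p * p)) + g x powr q * (a * b / (b powr q * q))"
        using a b f[OF x] g[OF x] by (simp add: powr_divide field_simps)
    qed (use fp gq fg in auto)
    then show ?thesis
      using fp gq by (simp add: A_def B_def field_simps)
  qed
  show "(\<integral>x. f x * g x \<partial>M)
      \<le> (\<integral>x. f x powr p \<partial>M) powr (1 / p) * (\<integral>x. g x powr q \<partial>M) powr (1 / q)"
  proof (cases "A = 0 \<or> B = 0")
    case True
    have "AE x in M. f x * g x = 0"
    proof (cases "A = 0")
      case True
      then have "AE x in M. f x powr p = 0"
        using integral_nonneg_eq_0_iff_AE[OF fp] unfolding A_def by auto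
      then show ?thesis by eventually_elim auto
    next
      case False
      with True have "AE x in M. g x powr q = 0"
        using integral_nonneg_eq_0_iff_AE[OF gq] unfolding B_def by auto
      then show ?thesis by eventually_elim auto
    qed
    then have "(\<integral>x. f x * g x \<partial>M) = 0"
      by (rule integral_eq_zero_AE)
    then show ?thesis by simp
  next
    case False
    then have "A > 0" "B > 0" using A0 B0 by auto
    moreover have "(A powr (1 / p)) powr p = A" "(B powr (1 / q)) powr q = B"
      using pq q A0 B0 by (auto simp: powr_powr)
    ultimately have "(\<integral>x. f x * g x \<partial>M)
        \<le> A powr (1 / p) * B powr (1 / q) * (1 / p + 1 / q)"
      using young[of "A powr (1 / p)" "B powr (1 / q)"]
      by (simp add: distrib_left)
    then show ?thesis using pq by (simp add: A_def B_def)
  qed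
qed

section \<open>Norming functionals\<close>

text \<open>These are the candidates for the Hahn-Banach argument. Homogeneity is asked as an
  inequality, which is easy to check for infima; scaling by 1 / c gives the reverse
  inequality.\<close>

definition sublinear_below_norm :: "('a::real_normed_vector \<Rightarrow> real) \<Rightarrow> bool" where
  "sublinear_below_norm p \<longleftrightarrow>
     (\<forall>x y. p (x + y) \<le> p x + p y) \<and> (\<forall>c>0. \<forall>x. p (c *\<^sub>R x) \<le> c * p x) \<and> (\<forall>x. p x \<le> norm x)"

text \<open>Subadditivity at 0 gives p 0 \<ge> 0 and the norm bound gives p 0 \<le> 0; the rest
  follows by writing 0 as x + (- x). The lower bound by the negative norm keeps all later infima
  finite.\<close>

lemma sublinear_below_norm_bounds:
  assumes "sublinear_below_norm p"
  shows "p 0 = 0" and "- p (- x) \<le> p x" and "- norm x \<le> p x"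
proof -
  have *: "p (x + y) \<le> p x + p y" "c > 0 \<Longrightarrow> p (c *\<^sub>R x) \<le> c * p x" "p x \<le> norm x" for x y c
    using assms by (auto simp: sublinear_below_norm_def)
  from *(1)[of 0 0] *(3)[of 0] show 0: "p 0 = 0" by simp
  from *(1)[of x "- x"] 0 show "- p (- x) \<le> p x" by simp
  with *(3)[of "- x"] show "- norm x \<le> p x" by simp
qed

text \<open>The infimal convolution of a sublinear \<open>p\<close> with the ray spanned by \<open>y\<close>; a minimal \<open>p\<close>
  coincides with it, which forces additivity in direction \<open>y\<close>.\<close>

lemma sublinear_below_norm_directional:
  fixes p :: "'a::real_normed_vector \<Rightarrow> real" and y :: 'a
  assumes p: "sublinear_below_norm p"
  defines "r \<equiv> \<lambda>x. INF t\<in>{0..}. p (x + t *\<^sub>R y) - t * p y"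
  shows "sublinear_below_norm r" and "r \<le> p"
    and "t \<ge> 0 \<Longrightarrow> r x \<le> p (x + t *\<^sub>R y) - t * p y"
proof -
  have p1: "p (x + y) \<le> p x + p y" and p2: "c > 0 \<Longrightarrow> p (c *\<^sub>R x) \<le> c * p x"
    and p3: "p x \<le> norm x" for x y c
    using p by (auto simp: sublinear_below_norm_def)
  note p4 = sublinear_below_norm_bounds[OF p]
  \<comment> \<open>The reverse direction of homogeneity; it shows that - norm x is a lower bound
    for the infimum defining \<open>r x\<close>.\<close>
  have p5: "t * p y \<le> p (t *\<^sub>R y)" if "t \<ge> 0" for t
  proof (cases "t = 0")
    case False
    with p2[of "1 / t" "t *\<^sub>R y"] that show ?thesis by (simp add: field_simps)
  qed (simp add: p4)
  have "- norm x \<le> p (x + t *\<^sub>R y) - t * p y" if "t \<ge> 0" for t x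
    using p1[of "x + t *\<^sub>R y" "- x"] p5[OF that] p3[of "- x"] by simp
  then have bdd: "bdd_below ((\<lambda>t. p (x + t *\<^sub>R y) - t * p y) ` {0..})" for x
    by (intro bdd_belowI2[where m = "- norm x"]) auto
  show le: "r x \<le> p (x + t *\<^sub>R y) - t * p y" if "t \<ge> 0" for t x
    unfolding r_def by (rule cINF_lower[OF bdd]) (use that in auto)
  have ge: "c \<le> r x" if "\<And>t. t \<ge> 0 \<Longrightarrow> c \<le> p (x + t *\<^sub>R y) - t * p y" for c x
    unfolding r_def by (rule cINF_greatest) (use that in auto)
  show rp: "r \<le> p"
    using le[of 0] by (auto simp: le_fun_def)
  show "sublinear_below_norm r"
    unfolding sublinear_below_norm_def
  proof (intro conjI allI impI)
    fix x x'
    \<comment> \<open>The infima over the two ray parameters are taken one after the other, with t +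
      t' as the parameter for x + x'.\<close>
    have "r (x + x') - (p (x' + t' *\<^sub>R y) - t' * p y) \<le> r x" if t': "t' \<ge> 0" for t'
    proof (rule ge)
      fix t :: real assume t: "t \<ge> 0"
      have "r (x + x') \<le> p ((x + t *\<^sub>R y) + (x' + t' *\<^sub>R y)) - (t + t') * p y"
        using le[of "t + t'" "x + x'"] t t' by (simp add: algebra_simps)
      also have "\<dots> \<le> p (x + t *\<^sub>R y) + p (x' + t' *\<^sub>R y) - (t + t') * p y"
        using p1 by simp
      finally show "r (x + x') - (p (x' + t' *\<^sub>R y) - t' * p y) \<le> p (x + t *\<^sub>R y) - t * p y"
        by (simp add: algebra_simps)
    qed
    then have "r (x + x') - r x \<le> r x'"
      by (intro ge) (simp add: algebra_simps)
    then show "r (x + x') \<le> r x + r x'" by simp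
  next
    fix c :: real and x assume c: "c > 0"
    have "r (c *\<^sub>R x) / c \<le> r x"
    proof (rule ge)
      fix t :: real assume t: "t \<ge> 0"
      have "r (c *\<^sub>R x) \<le> p (c *\<^sub>R (x + t *\<^sub>R y)) - (c * t) * p y"
        using le[of "c * t" "c *\<^sub>R x"] c t by (simp add: algebra_simps)
      also have "\<dots> \<le> c * p (x + t *\<^sub>R y) - (c * t) * p y"
        using p2[OF c] by simp
      finally show "r (c *\<^sub>R x) / c \<le> p (x + t *\<^sub>R y) - t * p y"
        using c by (simp add: field_simps)
    qed
    then show "r (c *\<^sub>R x) \<le> c * r x" using c by (simp add: field_simps)
  next
    fix x show "r x \<le> norm x"
      using rp p3[of x] by (auto simp: le_fun_def intro: order_trans)
  qed
qed

text \<open>The infimal convolution of f with the ray through y is again a candidate below f, hence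
  equals f. Its bound at t = 1 reads f x \<le> f (x + y) - f y, which is the converse of
  subadditivity. Additivity gives oddness and so homogeneity for negative factors.\<close>

lemma minimal_sublinear_below_norm_linear:
  fixes f :: "'a::real_normed_vector \<Rightarrow> real"
  assumes f: "sublinear_below_norm f"
    and min: "\<And>g. sublinear_below_norm g \<Longrightarrow> g \<le> f \<Longrightarrow> g = f"
  shows "bounded_linear f"
proof -
  note b = sublinear_below_norm_bounds[OF f]
  have sub: "f (x + y) \<le> f x + f y" for x y
    using f by (auto simp: sublinear_below_norm_def)
  have hom: "f (c *\<^sub>R x) \<le> c * f x" if "c > 0" for x c
    using f that by (auto simp: sublinear_below_norm_def)
  have add: "f (x + y) = f x + f y" for x y
  proof -
    note r = sublinear_below_norm_directional[OF f, where y = y]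
    have "f x \<le> f (x + 1 *\<^sub>R y) - 1 * f y"
      using r(3)[of 1 x] unfolding fun_cong[OF min[OF r(1,2)], of x] by simp
    with sub[of x y] show ?thesis by simp
  qed
  have neg: "f (- x) = - f x" for x
    using add[of x "- x"] b(1) by simp
  have pos: "f (c *\<^sub>R x) = c * f x" if c: "c > 0" for x c
    using hom[OF c, of x] hom[of "1 / c" "c *\<^sub>R x"] c by (simp add: field_simps)
  have scale: "f (c *\<^sub>R x) = c *\<^sub>R f x" for x c
  proof (cases c "0 :: real" rule: linorder_cases)
    case less
    with pos[of "- c" "- x"] neg[of x] show ?thesis by simp
  qed (use pos b in auto)
  have "\<bar>f x\<bar> \<le> norm x * 1" for x
    using f b(3)[of x] by (auto simp: sublinear_below_norm_def abs_le_iff)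
  then show ?thesis
    by (intro bounded_linear_intro[where K = 1]) (use add scale in auto)
qed

text \<open>Zorn's lemma, a chain being bounded below by its pointwise infimum. The infimum is
  subadditive because the smaller of two members of the chain can stand in for both.\<close>

lemma exists_minimal_sublinear_below_norm:
  fixes p :: "'a::real_normed_vector \<Rightarrow> real"
  assumes p: "sublinear_below_norm p"
  obtains f where "sublinear_below_norm f" "f \<le> p"
    and "\<And>g. sublinear_below_norm g \<Longrightarrow> g \<le> f \<Longrightarrow> g = f"
proof -
  define A where "A = {g. sublinear_below_norm g \<and> g \<le> p}"
  \<comment> \<open>The order is reversed, so that the maximal element supplied by Zorn's lemma is a
    minimal functional.\<close>
  have po: "partial_order_on A (relation_of (\<ge>) A)"
    by (auto simp: partial_order_on_def preorder_on_def refl_on_def trans_def antisym_def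
        relation_of_def)
  have "\<exists>u\<in>A. \<forall>g\<in>C. u \<le> g" if C: "C \<in> Chains (relation_of (\<ge>) A)" for C
  proof (cases "C = {}")
    case True
    with p show ?thesis by (auto simp: A_def)
  next
    case False
    have CA: "g \<in> A" if "g \<in> C" for g
      using C that by (auto simp: Chains_def relation_of_def)
    have total: "g \<le> g' \<or> g' \<le> g" if "g \<in> C" "g' \<in> C" for g g'
      using C that by (auto simp: Chains_def relation_of_def)
    have Cs: "g (x + y) \<le> g x + g y" "c > 0 \<Longrightarrow> g (c *\<^sub>R x) \<le> c * g x" "g x \<le> norm x"
      "- norm x \<le> g x" "g x \<le> p x"
      if "g \<in> C" for g x y c
      using CA[OF that] sublinear_below_norm_bounds(3)
      by (auto simp: A_def sublinear_below_norm_def le_fun_def)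
    define u where "u = (\<lambda>x. INF g\<in>C. g x)"
    have bdd: "bdd_below ((\<lambda>g. g x) ` C)" for x
      using Cs(4) by (intro bdd_belowI2[where m = "- norm x"]) auto
    have le: "u x \<le> g x" if "g \<in> C" for g x
      unfolding u_def by (rule cINF_lower[OF bdd that])
    have ge: "c \<le> u x" if "\<And>g. g \<in> C \<Longrightarrow> c \<le> g x" for c x
      unfolding u_def by (rule cINF_greatest) (use False that in auto)
    obtain g0 where g0: "g0 \<in> C" using False by auto
    have up: "u \<le> p"
      using le[OF g0] Cs(5)[OF g0] by (auto simp: le_fun_def intro: order_trans)
    have "sublinear_below_norm u"
      unfolding sublinear_below_norm_def
    proof (intro conjI allI impI)
      fix x y
      have "u (x + y) - g' y \<le> u x" if g': "g' \<in> C" for g'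
      proof (rule ge)
        fix g assume g: "g \<in> C"
        from total[OF g g'] obtain h where h: "h \<in> C" "h \<le> g" "h \<le> g'"
          using g g' by auto
        then show "u (x + y) - g' y \<le> g x"
          using le[OF h(1), of "x + y"] Cs(1)[OF h(1), of x y]
          by (auto simp: le_fun_def) (smt (verit))
      qed
      then have "u (x + y) - u x \<le> u y"
        by (intro ge) (simp add: algebra_simps)
      then show "u (x + y) \<le> u x + u y" by simp
    next
      fix c :: real and x assume c: "c > 0"
      have "u (c *\<^sub>R x) / c \<le> u x"
      proof (rule ge)
        fix g assume g: "g \<in> C"
        show "u (c *\<^sub>R x) / c \<le> g x"
          using le[OF g, of "c *\<^sub>R x"] Cs(2)[OF g c, of x] c by (simp add: field_simps)
      qed
      then show "u (c *\<^sub>R x) \<le> c * u x" using c by (simp add: field_simps)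
    next
      fix x show "u x \<le> norm x"
        using le[OF g0, of x] Cs(3)[OF g0, of x] by simp
    qed
    with up le show ?thesis by (intro bexI[of _ u]) (auto simp: A_def le_fun_def)
  qed
  from predicate_Zorn[OF po, OF this]
  obtain f where f: "f \<in> A" "\<And>g. g \<in> A \<Longrightarrow> g \<le> f \<Longrightarrow> g = f" by blast
  then have "g = f" if "sublinear_below_norm g" "g \<le> f" for g
    using that by (auto simp: A_def)
  with f(1) show ?thesis by (intro that[of f]) (auto simp: A_def)
qed

text \<open>The minimal functional is taken below the infimal convolution of the norm with the ray
  through v itself. There the value at - v is at most - norm v, which forces f v = norm v.\<close>

lemma exists_norming_functional:
  fixes v :: "'a::real_normed_vector"
  obtains f :: "'a \<Rightarrow> real" where "bounded_linear f" "\<And>x. \<bar>f x\<bar> \<le> norm x" "f v = norm v"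
proof -
  have n: "sublinear_below_norm (norm :: 'a \<Rightarrow> real)"
    by (auto simp: sublinear_below_norm_def norm_triangle_ineq)
  note r = sublinear_below_norm_directional[OF n, where y = v]
  obtain f where f: "sublinear_below_norm f"
      "f \<le> (\<lambda>x. INF t\<in>{0..}. norm (x + t *\<^sub>R v) - t * norm v)"
      "\<And>g. sublinear_below_norm g \<Longrightarrow> g \<le> f \<Longrightarrow> g = f"
    using exists_minimal_sublinear_below_norm[OF r(1)] by blast
  have lin: "bounded_linear f"
    by (rule minimal_sublinear_below_norm_linear[OF f(1,3)])
  have le: "f x \<le> norm x" for x
    using f(1) by (auto simp: sublinear_below_norm_def)
  have "f (- v) \<le> - norm v"
    using r(3)[of 1 "- v"] f(2) by (auto simp: le_fun_def intro: order_trans)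
  then have "f v = norm v"
    using le[of v] linear_neg[OF bounded_linear.linear[OF lin], of v] by simp
  moreover have "\<bar>f x\<bar> \<le> norm x" for x
    using le[of x] sublinear_below_norm_bounds(3)[OF f(1), of x] by simp
  ultimately show ?thesis using lin that by blast
qed

section \<open>Continuous selections almost attaining a supremum\<close>

text \<open>For each rational c the sets of all s with c < \<phi> s x are relatively open in A, so
  by Lindelof countably many x already cover the same part of A. The union of these countable
  families over all rational c is D; X may be arbitrarily large.\<close>

lemma countable_dense_supremum:
  fixes A :: "'b::second_countable_topology set" and \<phi> :: "'b \<Rightarrow> 'c \<Rightarrow> real"
  assumes cont: "\<And>x. x \<in> X \<Longrightarrow> continuous_on A (\<lambda>s. \<phi> s x)"
  shows "\<exists>D. countable D \<and> D \<subseteq> X \<and>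
    (\<forall>s\<in>A. \<forall>x\<in>X. \<forall>c<\<phi> s x. \<exists>y\<in>D. c < \<phi> s y)"
proof -
  define U where "U = (\<lambda>(c::real) x. {s\<in>A. c < \<phi> s x})"
  have "\<exists>E. countable E \<and> E \<subseteq> X \<and> (\<Union>x\<in>E. U c x) = (\<Union>x\<in>X. U c x)" for c
  proof -
    have "openin (top_of_set A) (U c x)" if "x \<in> X" for x
    proof -
      have "U c x = A \<inter> (\<lambda>s. \<phi> s x) -` {c<..}" by (auto simp: U_def)
      then show ?thesis
        using continuous_openin_preimage_gen[OF cont[OF that], of "{c<..}"] by simp
    qed
    then obtain F where F: "F \<subseteq> U c ` X" "countable F" "\<Union>F = \<Union>(U c ` X)"
      using Lindelof_openin[of "U c ` X" A] by (metis (no_types, lifting) imageE)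
    obtain E where "countable E" "E \<subseteq> X" "F = U c ` E"
      using F(1,2) by (metis countable_subset_image)
    with F(3) show ?thesis by blast
  qed
  then obtain E where E: "\<And>c. countable (E c)" "\<And>c. E c \<subseteq> X"
      "\<And>c. (\<Union>x\<in>E c. U c x) = (\<Union>x\<in>X. U c x)"
    by metis
  show ?thesis
  proof (intro exI[of _ "\<Union>c\<in>\<rat>. E c"] conjI ballI allI impI)
    show "countable (\<Union>c\<in>\<rat>. E c)" using E(1) countable_rat by blast
    show "(\<Union>c\<in>\<rat>. E c) \<subseteq> X" using E(2) by blast
    fix s x c assume "s \<in> A" "x \<in> X" "c < \<phi> s x"
    moreover from Rats_dense_in_real[OF this(3)]
    obtain d where d: "d \<in> \<rat>" "c < d" "d < \<phi> s x" by blast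
    ultimately have "s \<in> (\<Union>x\<in>E d. U d x)" unfolding E(3) by (auto simp: U_def)
    with d show "\<exists>y\<in>\<Union>c\<in>\<rat>. E c. c < \<phi> s y" by (force simp: U_def)
  qed
qed

text \<open>Starting from a constant, the selection is moved repeatedly along the segment towards
  the next element of a countable family. The fraction moved depends continuously on s, convexity
  keeps the result in X, and linearity of \<phi> s makes the values increase.\<close>

lemma continuous_maximizing_selection:
  fixes A :: "'b::second_countable_topology set" and \<phi> :: "'b \<Rightarrow> 'c::real_normed_vector \<Rightarrow> real"
  assumes cont: "\<And>x. x \<in> X \<Longrightarrow> continuous_on A (\<lambda>s. \<phi> s x)"
    and X: "convex X" "X \<noteq> {}"
    and lin: "\<And>s. s \<in> A \<Longrightarrow> linear (\<phi> s)"
    and bdd: "\<And>s. s \<in> A \<Longrightarrow> bdd_above (\<phi> s ` X)"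
  obtains u where "\<And>n::nat. continuous_on A (u n)" "\<And>n s. s \<in> A \<Longrightarrow> u n s \<in> X"
    "\<And>n. continuous_on A (\<lambda>s. \<phi> s (u n s))"
    "\<And>s. s \<in> A \<Longrightarrow> (\<lambda>n. \<phi> s (u n s)) \<longlonglongrightarrow> (SUP x\<in>X. \<phi> s x)"
proof -
  obtain D where D: "countable D" "D \<subseteq> X"
    "\<forall>s\<in>A. \<forall>x\<in>X. \<forall>c<\<phi> s x. \<exists>y\<in>D. c < \<phi> s y"
    using countable_dense_supremum[of X A \<phi>, OF cont] by auto
  obtain x0 where x0: "x0 \<in> X" using X by blast
  \<comment> \<open>Every element of \<open>D\<close> is listed infinitely often, so the error \<open>1 / (n + 1)\<close> made when
    passing to it can be made arbitrarily small.\<close>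
  define e where "e = (\<lambda>n. from_nat_into (insert x0 D) (fst (prod_decode n)))"
  have eX: "e n \<in> X" for n
  proof -
    have "e n \<in> insert x0 D" unfolding e_def by (rule from_nat_into) simp
    with D(2) x0 show ?thesis by blast
  qed
  have e_often: "\<exists>n\<ge>N. e n = y" if "y \<in> D" for y N
  proof -
    obtain k where k: "from_nat_into (insert x0 D) k = y"
      using from_nat_into_surj[of "insert x0 D" y] D(1) \<open>y \<in> D\<close> by auto
    \<comment> \<open>The second component of the pair is mere padding that pushes the index beyond
      \<open>N\<close>.\<close>
    have "N \<le> prod_encode (k, N)" by (rule le_prod_encode_2)
    with k show ?thesis by (intro exI[of _ "prod_encode (k, N)"]) (auto simp: e_def)
  qed
  \<comment> \<open>The fraction is 0 where \<open>e n\<close> brings no gain and 1 where the gain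
    is at least 1 / (n + 1). In between, the values fall short of that of \<open>e n\<close> by less
    than 1 / (n + 1).\<close>
  define \<theta> where "\<theta> = (\<lambda>n s x. max 0 (min 1 ((\<phi> s (e n) - \<phi> s x) * (real n + 1))))"
  define u where "u = rec_nat (\<lambda>s. x0) (\<lambda>n v s. v s + \<theta> n s (v s) *\<^sub>R (e n - v s))"
  have u0: "u 0 = (\<lambda>s. x0)"
    and uS: "u (Suc n) = (\<lambda>s. u n s + \<theta> n s (u n s) *\<^sub>R (e n - u n s))" for n
    by (simp_all add: u_def)
  have \<phi>S: "\<phi> s (u (Suc n) s) = \<phi> s (u n s) + \<theta> n s (u n s) * (\<phi> s (e n) - \<phi> s (u n s))"
    if "s \<in> A" for s n
    using lin[OF that] by (simp add: uS linear_add linear_diff linear_cmul)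
  have u_cont: "continuous_on A (u n) \<and> continuous_on A (\<lambda>s. \<phi> s (u n s))" for n
  proof (induction n)
    case 0
    then show ?case using cont[OF x0] by (simp add: u0)
  next
    case (Suc n)
    have \<theta>c: "continuous_on A (\<lambda>s. \<theta> n s (u n s))"
      unfolding \<theta>_def using Suc cont[OF eX] by (intro continuous_intros) auto
    have "continuous_on A (\<lambda>s. \<phi> s (u n s) + \<theta> n s (u n s) * (\<phi> s (e n) - \<phi> s (u n s)))"
      using Suc \<theta>c cont[OF eX] by (intro continuous_intros) auto
    then have "continuous_on A (\<lambda>s. \<phi> s (u (Suc n) s))"
      by (rule continuous_on_eq) (simp add: \<phi>S)
    moreover have "continuous_on A (u (Suc n))"
      unfolding uS using Suc \<theta>c by (intro continuous_intros) auto
    ultimately show ?case by blast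
  qed
  have uX: "u n s \<in> X" for n s
  proof (induction n)
    case (Suc n)
    have "u (Suc n) s = (1 - \<theta> n s (u n s)) *\<^sub>R u n s + \<theta> n s (u n s) *\<^sub>R e n"
      by (simp add: uS algebra_simps)
    also have "\<dots> \<in> X"
      using Suc eX[of n] by (intro convexD[OF X(1)]) (auto simp: \<theta>_def)
    finally show ?case .
  qed (simp add: u0 x0)
  have step: "\<phi> s (u n s) \<le> \<phi> s (u (Suc n) s) \<and> \<phi> s (e n) - 1 / (real n + 1) \<le> \<phi> s (u (Suc n) s)"
    if s: "s \<in> A" for s n
  proof -
    define d where "d = \<phi> s (e n) - \<phi> s (u n s)"
    define k where "k = real n + 1"
    have k: "k > 0" by (simp add: k_def)
    have th: "\<theta> n s (u n s) = max 0 (min 1 (d * k))" by (simp add: \<theta>_def d_def k_def)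
    consider "d \<le> 0" | "d > 0" "d * k < 1" | "d > 0" "d * k \<ge> 1" by linarith
    then have "0 \<le> max 0 (min 1 (d * k)) * d \<and> d - 1 / k \<le> max 0 (min 1 (d * k)) * d"
    proof cases
      case 1
      then have "d * k \<le> 0" using k by (simp add: mult_nonpos_nonneg)
      with 1 k show ?thesis by (auto simp: max_def min_def intro: order_trans[of _ 0])
    next
      case 2
      then have "d < 1 / k" using k by (simp add: field_simps)
      moreover have "0 \<le> max 0 (min 1 (d * k)) * d" using 2 by simp
      ultimately show ?thesis by simp
    next
      case 3
      then show ?thesis using k by (auto simp: max_def min_def)
    qed
    then show ?thesis unfolding \<phi>S[OF s] th d_def[symmetric] k_def[symmetric]
      by (auto simp: d_def)
  qed
  have lim: "(\<lambda>n. \<phi> s (u n s)) \<longlonglongrightarrow> (SUP x\<in>X. \<phi> s x)" if s: "s \<in> A" for s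
  proof -
    have inc: "incseq (\<lambda>n. \<phi> s (u n s))"
      by (rule incseq_SucI) (use step[OF s] in blast)
    have up: "\<phi> s (u n s) \<le> (SUP x\<in>X. \<phi> s x)" for n
      by (rule cSUP_upper[OF uX bdd[OF s]])
    show ?thesis
    proof (rule increasing_tendsto)
      show "\<forall>\<^sub>F n in sequentially. \<phi> s (u n s) \<le> (SUP x\<in>X. \<phi> s x)" using up by simp
      fix c assume "c < (SUP x\<in>X. \<phi> s x)"
      then obtain x where "x \<in> X" "c < \<phi> s x"
        using less_cSUP_iff[OF X(2) bdd[OF s]] by blast
      with D(3) s obtain y where y: "y \<in> D" "c < \<phi> s y" by blast
      obtain N :: nat where N: "1 / (real N + 1) < \<phi> s y - c"
        using y(2) nat_approx_posE[of "\<phi> s y - c"] by (auto simp: add.commute)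
      obtain n where n: "n \<ge> N" "e n = y" using e_often[OF y(1)] by blast
      have "1 / (real n + 1) \<le> 1 / (real N + 1)" using n(1) by (simp add: field_simps)
      with step[OF s, of n] N n(2) have "c < \<phi> s (u (Suc n) s)" by simp
      then have "c < \<phi> s (u m s)" if "m \<ge> Suc n" for m
        using incseqD[OF inc that] by simp
      then show "\<forall>\<^sub>F n in sequentially. c < \<phi> s (u n s)"
        using eventually_sequentially by blast
    qed
  qed
  show ?thesis
    by (rule that[of u]) (use u_cont uX lim in auto)
qed

section \<open>Integration over an open interval\<close>

lemma finite_measure_open_interval: "finite_measure (lebesgue_on {0<..<T::real})"
  by (rule finite_measure_lebesgue_on) (simp add: lmeasurable_open)

lemma integrable_bounded_open_interval:
  fixes f :: "real \<Rightarrow> real"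
  assumes "f \<in> borel_measurable (lebesgue_on {0<..<T})" "\<And>s. s \<in> {0<..<T} \<Longrightarrow> \<bar>f s\<bar> \<le> B"
  shows "integrable (lebesgue_on {0<..<T}) f"
proof -
  interpret finite_measure "lebesgue_on {0<..<T}" by (rule finite_measure_open_interval)
  show ?thesis
    by (rule integrable_const_bound[where B = B]) (use assms in \<open>auto intro!: AE_I2\<close>)
qed

lemma continuous_measurable_open_interval:
  fixes f :: "real \<Rightarrow> 'b::euclidean_space"
  assumes "continuous_on {0..T} f"
  shows "f \<in> borel_measurable (lebesgue_on {0<..<T})"
  by (rule continuous_imp_measurable_on_sets_lebesgue)
    (auto intro: continuous_on_subset[OF assms])

lemma continuous_bounded_on_Icc:
  fixes f :: "real \<Rightarrow> real"
  assumes "continuous_on {a..b} f"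
  obtains B where "B > 0" "\<And>s. s \<in> {a..b} \<Longrightarrow> \<bar>f s\<bar> \<le> B"
proof -
  have "bounded (f ` {a..b})"
    by (rule compact_imp_bounded[OF compact_continuous_image[OF assms]]) simp
  then obtain B where "\<forall>x\<in>f ` {a..b}. norm x \<le> B" "B > 0" by (auto simp: bounded_pos)
  with that show ?thesis by auto
qed

text \<open>This links the Lebesgue integral over the open interval to the Henstock-Kurzweil
  integral, in which the fundamental theorem of calculus is applied; the endpoints form a null
  set.\<close>

lemma continuous_integral_open_interval:
  fixes f :: "real \<Rightarrow> real"
  assumes "continuous_on {0..T} f"
  shows "integrable (lebesgue_on {0<..<T}) f"
    and "integral\<^sup>L (lebesgue_on {0<..<T}) f = integral {0..T} f"
proof -
  obtain B where "\<And>s. s \<in> {0..T} \<Longrightarrow> \<bar>f s\<bar> \<le> B"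
    using continuous_bounded_on_Icc[OF assms] by blast
  then show *: "integrable (lebesgue_on {0<..<T}) f"
    by (intro integrable_bounded_open_interval[where B = B] continuous_measurable_open_interval assms)
      auto
  have "integral\<^sup>L (lebesgue_on {0<..<T}) f = integral {0<..<T} f"
    by (rule lebesgue_integral_eq_integral[OF *]) auto
  then show "integral\<^sup>L (lebesgue_on {0<..<T}) f = integral {0..T} f"
    by (simp add: integral_open_interval_real)
qed

lemma weighted_norm_lebesgue_on:
  assumes "I \<in> sets lebesgue"
  shows "weighted_norm \<omega> r I f
    = (\<integral>s. (exp (- \<omega> * s) * norm (f s)) powr r \<partial>lebesgue_on I) powr (1 / r)"
  using assms by (simp add: weighted_norm_def integral_restrict_space set_lebesgue_integral_def)

section \<open>Reflection of the interval in its midpoint\<close>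

lemma reflection_measurable:
  "(\<lambda>s. T - s) \<in> lebesgue_on {0<..<T::real} \<rightarrow>\<^sub>M lebesgue_on {0<..<T}"
proof -
  have "(\<lambda>s::real. T - s) \<in> lebesgue \<rightarrow>\<^sub>M lebesgue"
    using lebesgue_affine_measurable[where c = "\<lambda>_::real. -1" and t = T] by simp
  then show ?thesis
    by (intro measurable_restrict_space2 measurable_restrict_space1) auto
qed

text \<open>An affine map of slope -1 preserves Lebesgue measure, and this one maps the interval
  onto itself.\<close>

lemma distr_reflection_open_interval:
  "distr (lebesgue_on {0<..<T::real}) (lebesgue_on {0<..<T}) (\<lambda>s. T - s) = lebesgue_on {0<..<T}"
proof (rule measure_eqI)
  have meas: "(\<lambda>s::real. T - s) \<in> lebesgue \<rightarrow>\<^sub>M lebesgue"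
    using lebesgue_affine_measurable[where c = "\<lambda>_::real. -1" and t = T] by simp
  have "lebesgue = density (distr lebesgue lebesgue (\<lambda>x. T + - 1 * x)) (\<lambda>_. ennreal \<bar>- 1\<bar>)"
    by (rule lebesgue_real_affine) simp
  then have leb: "distr lebesgue lebesgue (\<lambda>s. T - s) = lebesgue"
    by (simp add: density_1)
  fix A assume "A \<in> sets (distr (lebesgue_on {0<..<T}) (lebesgue_on {0<..<T}) (\<lambda>s. T - s))"
  then have A: "A \<in> sets (lebesgue_on {0<..<T})" by simp
  then have A': "A \<in> sets lebesgue" "A \<subseteq> {0<..<T}"
    by (auto simp: sets_restrict_space)
  have eq: "(\<lambda>s. T - s) -` A \<inter> {0<..<T} = (\<lambda>s. T - s) -` A"
    using A'(2) by force
  have "emeasure (distr (lebesgue_on {0<..<T}) (lebesgue_on {0<..<T}) (\<lambda>s. T - s)) A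
      = emeasure (lebesgue_on {0<..<T}) ((\<lambda>s. T - s) -` A \<inter> {0<..<T})"
    using A by (subst emeasure_distr) (auto intro: reflection_measurable)
  also have "\<dots> = emeasure lebesgue ((\<lambda>s. T - s) -` A)"
    unfolding eq by (rule emeasure_restrict_space) (use A'(2) in force)+
  also have "\<dots> = emeasure (distr lebesgue lebesgue (\<lambda>s. T - s)) A"
    using A'(1) by (subst emeasure_distr) (auto intro: meas)
  also have "\<dots> = emeasure (lebesgue_on {0<..<T}) A"
    unfolding leb by (rule emeasure_restrict_space[symmetric]) (use A'(2) in auto)
  finally show "emeasure (distr (lebesgue_on {0<..<T}) (lebesgue_on {0<..<T}) (\<lambda>s. T - s)) A
      = emeasure (lebesgue_on {0<..<T}) A" .
qed simp

lemma integral_reflection_open_interval: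
  fixes f :: "real \<Rightarrow> real"
  assumes f: "f \<in> borel_measurable (lebesgue_on {0<..<T})"
  shows "(\<lambda>s. f (T - s)) \<in> borel_measurable (lebesgue_on {0<..<T})"
    and "integrable (lebesgue_on {0<..<T}) (\<lambda>s. f (T - s)) \<longleftrightarrow> integrable (lebesgue_on {0<..<T}) f"
    and "(\<integral>s. f (T - s) \<partial>lebesgue_on {0<..<T}) = integral\<^sup>L (lebesgue_on {0<..<T}) f"
proof -
  show "(\<lambda>s. f (T - s)) \<in> borel_measurable (lebesgue_on {0<..<T})"
    by (rule measurable_compose[OF reflection_measurable f])
  show "integrable (lebesgue_on {0<..<T}) (\<lambda>s. f (T - s)) \<longleftrightarrow> integrable (lebesgue_on {0<..<T}) f"
    using integrable_distr_eq[OF reflection_measurable f]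
    by (simp add: distr_reflection_open_interval)
  show "(\<integral>s. f (T - s) \<partial>lebesgue_on {0<..<T}) = integral\<^sup>L (lebesgue_on {0<..<T}) f"
    using integral_distr[OF reflection_measurable f]
    by (simp add: distr_reflection_open_interval)
qed

section \<open>Boundedness of the convolution operator\<close>

text \<open>Extension by zero turns a continuous function on [0, T] into an element of the weighted
  space on the half-line, while its convolution at times up to T involves only the original
  values.\<close>

definition cutoff :: "real \<Rightarrow> (real \<Rightarrow> 'a::zero) \<Rightarrow> real \<Rightarrow> 'a" where
  "cutoff T u s = (if s \<in> {0..T} then u s else 0)"

text \<open>The simple functions sample u at the largest grid point of mesh 1 / (i + 1) below the
  argument; continuity of u gives pointwise convergence, without any separability of the
  space.\<close>

lemma strongly_measurable_cutoff:
  fixes u :: "real \<Rightarrow> 'a::real_normed_vector"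
  assumes u: "continuous_on {0..T} u"
  shows "strongly_measurable (lebesgue_on {0..}) (cutoff T u)"
  unfolding strongly_measurable_def
proof (intro exI conjI allI AE_I2)
  define g where "g = (\<lambda>(i::nat) x. real_of_int \<lfloor>x * (real i + 1)\<rfloor> / (real i + 1))"
  \<comment> \<open>The value -1 marks the points outside [0, T]; it cannot collide with a grid
    point, these being nonnegative there, and \<open>v\<close> sends it to 0.\<close>
  define g' where "g' = (\<lambda>i x. if x \<in> {0..T} then g i x else - 1)"
  define v where "v = (\<lambda>r::real. if r < 0 then 0 else u r)"
  have g0: "g i x \<ge> 0" if "x \<ge> 0" for i x using that by (auto simp: g_def)
  have gx: "g i x \<le> x" for i x by (simp add: g_def divide_simps)
  have xg: "x - 1 / (real i + 1) \<le> g i x" for i x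
  proof -
    have "x * (real i + 1) - 1 \<le> real_of_int \<lfloor>x * (real i + 1)\<rfloor>" by linarith
    then have "(x * (real i + 1) - 1) / (real i + 1)
        \<le> real_of_int \<lfloor>x * (real i + 1)\<rfloor> / (real i + 1)"
      by (rule divide_right_mono) simp
    moreover have "(x * (real i + 1) - 1) / (real i + 1) = x - 1 / (real i + 1)"
      by (simp add: field_simps)
    ultimately show ?thesis by (simp add: g_def)
  qed
  fix i
  show "simple_function (lebesgue_on {0..}) (\<lambda>x. v (g' i x))"
  proof (rule simple_function_compose1[where f = "g' i"], rule simple_function_borel_measurable)
    have "g' i \<in> borel_measurable borel" unfolding g'_def g_def by measurable
    then show "g' i \<in> borel_measurable (lebesgue_on {0..})"
      by (intro measurable_restrict_space1 measurable_completion) simp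
    have "g' i ` space (lebesgue_on {0..})
        \<subseteq> insert (- 1) ((\<lambda>k. real_of_int k / (real i + 1)) ` {0..\<lfloor>T * (real i + 1)\<rfloor>})"
      by (auto simp: g'_def g_def intro!: imageI floor_mono mult_right_mono)
    then show "finite (g' i ` space (lebesgue_on {0..}))"
      by (rule finite_subset) auto
  qed
  fix x assume "x \<in> space (lebesgue_on {0::real..})"
  show "(\<lambda>i. v (g' i x)) \<longlonglongrightarrow> cutoff T u x"
  proof (cases "x \<in> {0..T}")
    case True
    have "(\<lambda>i. x - 1 / (real i + 1)) \<longlonglongrightarrow> x - 0"
      by (intro tendsto_diff tendsto_const)
        (use LIMSEQ_inverse_real_of_nat in \<open>simp add: inverse_eq_divide add.commute\<close>)
    then have "(\<lambda>i. g i x) \<longlonglongrightarrow> x"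
      by (intro tendsto_sandwich[of "\<lambda>i. x - 1 / (real i + 1)" "\<lambda>i. g i x" sequentially "\<lambda>i. x"])
        (use gx xg in auto)
    then have "(\<lambda>i. u (g i x)) \<longlonglongrightarrow> u x"
      by (rule continuous_on_tendsto_compose[OF u])
        (use True g0 order_trans[OF gx] in auto)
    moreover have "v (g' i x) = u (g i x)" for i
      using True g0[of x i] by (simp add: v_def g'_def)
    ultimately show ?thesis using True by (simp add: cutoff_def)
  next
    case False
    then show ?thesis by (auto simp: v_def g'_def cutoff_def)
  qed
qed

lemma integral_cutoff:
  fixes f :: "real \<Rightarrow> real"
  assumes f: "continuous_on {0..T} f"
  shows "set_integrable lebesgue {0..} (cutoff T f)"
    and "(LINT s:{0..}|lebesgue. cutoff T f s) = (\<integral>s. f s \<partial>lebesgue_on {0<..<T})"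
proof -
  have eq: "indicator {0<..<T} s *\<^sub>R f s = indicator {0..} s *\<^sub>R cutoff T f s"
    if "s \<noteq> 0" "s \<noteq> T" for s
    using that by (auto simp: indicator_def cutoff_def)
  have "AE s in lebesgue. s \<noteq> 0 \<and> s \<noteq> T"
    by (intro AE_completion AE_conjI AE_lborel_singleton)
  then have ae: "AE s in lebesgue. indicator {0<..<T} s *\<^sub>R f s = indicator {0..} s *\<^sub>R cutoff T f s"
    by eventually_elim (use eq in auto)
  have int: "integrable lebesgue (\<lambda>s. indicator {0<..<T} s *\<^sub>R f s)"
    using continuous_integral_open_interval(1)[OF f] by (simp add: integrable_restrict_space)
  have "(\<lambda>s. if s \<in> {0..T} then f s else 0) \<in> borel_measurable borel"
    by (rule borel_measurable_continuous_on_if) (use f in auto)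
  then have [measurable]: "cutoff T f \<in> borel_measurable borel"
    unfolding cutoff_def[abs_def] .
  have "(\<lambda>s. indicator {0..} s *\<^sub>R cutoff T f s) \<in> borel_measurable borel"
    by measurable
  then have m: "(\<lambda>s. indicator {0..} s *\<^sub>R cutoff T f s) \<in> borel_measurable lebesgue"
    by (intro measurable_completion) simp
  show "set_integrable lebesgue {0..} (cutoff T f)"
    unfolding set_integrable_def
    by (rule integrable_cong_AE_imp[OF int m]) (use ae in \<open>auto elim: eventually_mono\<close>)
  show "(LINT s:{0..}|lebesgue. cutoff T f s) = (\<integral>s. f s \<partial>lebesgue_on {0<..<T})"
    unfolding set_lebesgue_integral_def
    using integral_cong_AE[OF borel_measurable_integrable[OF int] m ae]
    by (simp add: integral_restrict_space)
qed

lemma weighted_Lp_cutoff: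
  fixes u :: "real \<Rightarrow> 'a::real_normed_vector"
  assumes u: "continuous_on {0..T} u" and r: "r > 0"
  shows "cutoff T u \<in> weighted_Lp \<omega> r"
    and "weighted_norm \<omega> r {0..} (cutoff T u) = weighted_norm \<omega> r {0<..<T} u"
proof -
  define f where "f = (\<lambda>s. (exp (- \<omega> * s) * norm (u s)) powr r)"
  have f: "continuous_on {0..T} f"
    unfolding f_def using u r by (intro continuous_intros continuous_on_powr') auto
  have eq: "(exp (- \<omega> * s) * norm (cutoff T u s)) powr r = cutoff T f s" for s
    using r by (simp add: cutoff_def f_def)
  show "cutoff T u \<in> weighted_Lp \<omega> r"
    unfolding weighted_Lp_def mem_Collect_eq eq
    using strongly_measurable_cutoff[OF u] integral_cutoff(1)[OF f] by auto
  show "weighted_norm \<omega> r {0..} (cutoff T u) = weighted_norm \<omega> r {0<..<T} u"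
    unfolding weighted_norm_def eq integral_cutoff(2)[OF f]
    by (simp add: f_def integral_restrict_space set_lebesgue_integral_def)
qed

text \<open>The constant C of boundedness, whose sign is unknown, makes the set of quotients bounded
  above. An element of norm zero contributes the quotient 0 and is not controlled by the supremum,
  so C is used for it directly.\<close>

lemma conv_norm_bound:
  assumes K: "conv_bounded S \<omega> p"
  shows "conv_norm S \<omega> p \<ge> 0"
    and "u \<in> weighted_Lp \<omega> p \<Longrightarrow>
      weighted_norm \<omega> p {0..} (conv_op S u) \<le> conv_norm S \<omega> p * weighted_norm \<omega> p {0..} u"
proof -
  obtain C where C: "\<And>u. u \<in> weighted_Lp \<omega> p \<Longrightarrow>
      weighted_norm \<omega> p {0..} (conv_op S u) \<le> C * weighted_norm \<omega> p {0..} u"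
    using K by (auto simp: conv_bounded_def)
  have n0: "weighted_norm \<omega> p {0..} v \<ge> 0" for v :: "real \<Rightarrow> 'a"
    by (simp add: weighted_norm_def)
  define R where
    "R = (\<lambda>u. weighted_norm \<omega> p {0..} (conv_op S u) / weighted_norm \<omega> p {0..} u)"
  have "R u \<le> \<bar>C\<bar>" if "u \<in> weighted_Lp \<omega> p" for u
  proof (cases "weighted_norm \<omega> p {0..} u = 0")
    case False
    with n0[of u] have "weighted_norm \<omega> p {0..} u > 0" by linarith
    with C[OF that] have "R u \<le> C" by (simp add: R_def field_simps)
    then show ?thesis by simp
  qed (simp add: R_def)
  then have bdd: "bdd_above (R ` weighted_Lp \<omega> p)" by (intro bdd_aboveI2) auto
  have R_le: "R u \<le> conv_norm S \<omega> p" if "u \<in> weighted_Lp \<omega> p" for u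
    unfolding conv_norm_def using cSUP_upper[OF that bdd] by (simp add: R_def)
  have "(\<lambda>_. 0::'a) \<in> weighted_Lp \<omega> p"
    by (auto simp: weighted_Lp_def strongly_measurable_def set_integrable_def
        intro!: exI[of _ "\<lambda>_ _. 0"])
  from R_le[OF this] show "conv_norm S \<omega> p \<ge> 0"
    using n0 by (auto simp: R_def intro: order_trans[rotated])
  assume u: "u \<in> weighted_Lp \<omega> p"
  show "weighted_norm \<omega> p {0..} (conv_op S u) \<le> conv_norm S \<omega> p * weighted_norm \<omega> p {0..} u"
  proof (cases "weighted_norm \<omega> p {0..} u = 0")
    case True
    with C[OF u] show ?thesis by simp
  next
    case False
    with n0[of u] have "weighted_norm \<omega> p {0..} u > 0" by linarith
    with R_le[OF u] show ?thesis by (simp add: R_def field_simps)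
  qed
qed

text \<open>Restricting the output from the half-line to (0, T) only decreases its integral, and the
  input vanishes beyond T. So the operator bound localises to (0, T), here raised to the power
  p.\<close>

lemma conv_op_cutoff_estimate:
  fixes S :: "real \<Rightarrow> 'a::complex_banach \<Rightarrow> 'a"
  assumes K: "conv_bounded S \<omega> p" and p: "p > 1" and u: "continuous_on {0..T} u"
  defines "w \<equiv> \<lambda>s. exp (- \<omega> * s) * norm (conv_op S (cutoff T u) s)"
  shows "w \<in> borel_measurable (lebesgue_on {0<..<T})"
    and "integrable (lebesgue_on {0<..<T}) (\<lambda>s. w s powr p)"
    and "(\<integral>s. w s powr p \<partial>lebesgue_on {0<..<T})
      \<le> conv_norm S \<omega> p powr p * (\<integral>s. (exp (- \<omega> * s) * norm (u s)) powr p \<partial>lebesgue_on {0<..<T})"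
proof -
  have uL: "cutoff T u \<in> weighted_Lp \<omega> p" using weighted_Lp_cutoff(1)[OF u] p by simp
  have "conv_op S (cutoff T u) \<in> weighted_Lp \<omega> p"
    using K uL by (auto simp: conv_bounded_def)
  then have int: "set_integrable lebesgue {0..} (\<lambda>s. w s powr p)"
    by (auto simp: weighted_Lp_def w_def)
  have sub: "set_integrable lebesgue {0<..<T} (\<lambda>s. w s powr p)"
    by (rule set_integrable_subset[OF int]) auto
  then show int': "integrable (lebesgue_on {0<..<T}) (\<lambda>s. w s powr p)"
    by (simp add: set_integrable_def integrable_restrict_space)
  \<comment> \<open>Measurability of \<open>w\<close> is recovered from that of its p-th power by
    taking the root.\<close>
  have "(\<lambda>s. (w s powr p) powr (1 / p)) \<in> borel_measurable (lebesgue_on {0<..<T})"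
    using borel_measurable_integrable[OF int'] by measurable
  moreover have "(w s powr p) powr (1 / p) = w s" for s
    using p by (simp add: powr_powr w_def)
  ultimately show "w \<in> borel_measurable (lebesgue_on {0<..<T})" by simp
  define A where "A = (\<integral>s. (exp (- \<omega> * s) * norm (u s)) powr p \<partial>lebesgue_on {0<..<T})"
  define B where "B = (LINT s:{0..}|lebesgue. w s powr p)"
  have A0: "A \<ge> 0" unfolding A_def by (auto intro!: integral_nonneg_AE)
  have B0: "B \<ge> 0" unfolding B_def set_lebesgue_integral_def by (auto intro!: integral_nonneg_AE)
  have "weighted_norm \<omega> p {0..} (conv_op S (cutoff T u)) = B powr (1 / p)"
    by (simp add: weighted_norm_def B_def w_def)
  moreover have "weighted_norm \<omega> p {0..} (cutoff T u) = A powr (1 / p)"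
    using weighted_Lp_cutoff(2)[OF u] p by (simp add: A_def weighted_norm_lebesgue_on)
  ultimately have "B powr (1 / p) \<le> conv_norm S \<omega> p * A powr (1 / p)"
    using conv_norm_bound(2)[OF K uL] by simp
  then have "(B powr (1 / p)) powr p \<le> (conv_norm S \<omega> p * A powr (1 / p)) powr p"
    using p by (intro powr_mono2) auto
  then have "B \<le> conv_norm S \<omega> p powr p * A"
    using p A0 B0 conv_norm_bound(1)[OF K] by (simp add: powr_mult powr_powr)
  moreover have "(\<integral>s. w s powr p \<partial>lebesgue_on {0<..<T}) = (LINT s:{0<..<T}|lebesgue. w s powr p)"
    by (simp add: integral_restrict_space set_lebesgue_integral_def)
  moreover have "(LINT s:{0<..<T}|lebesgue. w s powr p) \<le> B"
    unfolding B_def set_lebesgue_integral_def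
    by (rule integral_mono)
      (use int sub in \<open>auto simp: set_integrable_def indicator_def\<close>)
  ultimately show "(\<integral>s. w s powr p \<partial>lebesgue_on {0<..<T})
      \<le> conv_norm S \<omega> p powr p * (\<integral>s. (exp (- \<omega> * s) * norm (u s)) powr p \<partial>lebesgue_on {0<..<T})"
    by (simp add: A_def)
qed

section \<open>Weighted estimates for orbits and dual orbits\<close>

locale convolution_bounded_semigroup =
  fixes S :: "real \<Rightarrow> 'a::complex_banach \<Rightarrow> 'a" and \<omega> p q :: real and m :: "real \<Rightarrow> real"
  assumes semigroup: "C0_semigroup S"
    and p: "p > 1" and pq: "1 / p + 1 / q = 1"
    and K: "conv_bounded S \<omega> p"
    and m_cont: "continuous_on {0..} m"
    and S_le: "\<And>s. s \<ge> 0 \<Longrightarrow> onorm (S s) \<le> m s"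
begin

section \<open>Elementary bounds and joint continuity of the semigroup\<close>

lemma q: "q > 1"
  by (rule conjugate_exponent_gt_1[OF p pq])

lemma S_linear: "s \<ge> 0 \<Longrightarrow> bounded_linear (S s)"
  using semigroup by (auto simp: C0_semigroup_def bounded_clinear_def)

lemma S_add: "s \<ge> 0 \<Longrightarrow> t \<ge> 0 \<Longrightarrow> S (s + t) x = S s (S t x)"
  using semigroup by (auto simp: C0_semigroup_def)

lemma S_cont: "continuous_on {0..} (\<lambda>s. S s x)"
  using semigroup by (auto simp: C0_semigroup_def)

lemma S_norm: "s \<ge> 0 \<Longrightarrow> norm (S s x) \<le> m s * norm x"
  using onorm[OF S_linear, of s x] S_le[of s] by (meson mult_right_mono norm_ge_zero order_trans)

lemma m_nonneg: "s \<ge> 0 \<Longrightarrow> m s \<ge> 0"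
  using onorm_pos_le[OF S_linear, of s] S_le[of s] by simp

text \<open>The difference splits into S (g s) applied to u s - u a, controlled by m, and the
  variation of the orbit of the fixed vector u a, controlled by strong continuity.\<close>

lemma continuous_on_S:
  assumes g: "continuous_on A g" "\<And>s. s \<in> A \<Longrightarrow> g s \<ge> 0" and u: "continuous_on A u"
  shows "continuous_on A (\<lambda>s. S (g s) (u s))"
  unfolding continuous_on_def
proof
  fix a assume a: "a \<in> A"
  have sub: "g ` A \<subseteq> {0..}" using g(2) by auto
  have "continuous_on A (\<lambda>s. m (g s) * norm (u s - u a) + norm (S (g s) (u a) - S (g a) (u a)))"
    by (intro continuous_intros u continuous_on_compose2[OF m_cont g(1) sub]
        continuous_on_compose2[OF S_cont g(1) sub])
  then have lim: "((\<lambda>s. m (g s) * norm (u s - u a) + norm (S (g s) (u a) - S (g a) (u a)))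
      \<longlongrightarrow> 0) (at a within A)"
    using a by (auto simp: continuous_on_def)
  have bound: "norm (S (g s) (u s) - S (g a) (u a))
      \<le> m (g s) * norm (u s - u a) + norm (S (g s) (u a) - S (g a) (u a))" if "s \<in> A" for s
  proof -
    have "S (g s) (u s) - S (g a) (u a)
        = S (g s) (u s - u a) + (S (g s) (u a) - S (g a) (u a))"
      using linear_diff[OF bounded_linear.linear[OF S_linear[OF g(2)[OF that]]]] by simp
    then have "norm (S (g s) (u s) - S (g a) (u a))
        \<le> norm (S (g s) (u s - u a)) + norm (S (g s) (u a) - S (g a) (u a))"
      by (metis norm_triangle_ineq)
    with S_norm[OF g(2)[OF that], of "u s - u a"] show ?thesis by linarith
  qed
  have "\<forall>\<^sub>F s in at a within A. norm (S (g s) (u s) - S (g a) (u a))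
      \<le> m (g s) * norm (u s - u a) + norm (S (g s) (u a) - S (g a) (u a))"
    using bound by (auto simp: eventually_at_filter)
  from Lim_null_comparison[OF this lim]
  show "((\<lambda>s. S (g s) (u s)) \<longlongrightarrow> S (g a) (u a)) (at a within A)"
    by (simp add: LIM_zero_iff)
qed

text \<open>By the semigroup law, S (s - r) maps \<Phi>' r times S r x to \<Phi>' r times S s x. The
  integrand of the convolution is thus a scalar function times a fixed vector, and integrating
  \<Phi>' from 0 yields \<Phi>.\<close>

lemma orbit_estimate:
  fixes \<Phi> \<Phi>' :: "real \<Rightarrow> real"
  assumes \<Phi>: "\<And>s. s \<in> {0..T} \<Longrightarrow> (\<Phi> has_real_derivative \<Phi>' s) (at s within {0..T})"
    and \<Phi>': "continuous_on {0..T} \<Phi>'" and \<Phi>0: "\<Phi> 0 = 0" and \<Phi>_nonneg: "\<And>s. s \<ge> 0 \<Longrightarrow> \<Phi> s \<ge> 0"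
  shows "(\<integral>s. (exp (- \<omega> * s) * (\<Phi> s * norm (S s x))) powr p \<partial>lebesgue_on {0<..<T})
    \<le> conv_norm S \<omega> p powr p *
      (\<integral>s. (exp (- \<omega> * s) * (\<bar>\<Phi>' s\<bar> * norm (S s x))) powr p \<partial>lebesgue_on {0<..<T})"
proof -
  define u where "u = (\<lambda>s. \<Phi>' s *\<^sub>R S s x)"
  have u: "continuous_on {0..T} u"
    unfolding u_def by (intro continuous_intros \<Phi>' continuous_on_subset[OF S_cont]) auto
  have conv: "conv_op S (cutoff T u) s = \<Phi> s *\<^sub>R S s x" if s: "s \<in> {0..T}" for s
  proof -
    have "(\<Phi>' has_integral (\<Phi> s - \<Phi> 0)) {0..s}"
    proof (rule fundamental_theorem_of_calculus)
      fix r assume r: "r \<in> {0..s}"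
      then have "(\<Phi> has_real_derivative \<Phi>' r) (at r within {0..T})" using s \<Phi> by auto
      then have "(\<Phi> has_real_derivative \<Phi>' r) (at r within {0..s})"
        by (rule DERIV_subset) (use s in auto)
      then show "(\<Phi> has_vector_derivative \<Phi>' r) (at r within {0..s})"
        by (simp add: has_real_derivative_iff_has_vector_derivative)
    qed (use s in auto)
    then have "((\<lambda>r. \<Phi>' r *\<^sub>R S s x) has_integral (\<Phi> s *\<^sub>R S s x)) {0..s}"
      using has_integral_scaleR_left[of \<Phi>' "\<Phi> s" "{0..s}" "S s x"] \<Phi>0 by simp
    moreover have "\<Phi>' r *\<^sub>R S s x = S (s - r) (cutoff T u r)" if "r \<in> {0..s}" for r
      using that s S_add[of "s - r" r x] linear_cmul[OF bounded_linear.linear[OF S_linear[of "s - r"]]]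
      by (simp add: cutoff_def u_def)
    ultimately have "((\<lambda>r. S (s - r) (cutoff T u r)) has_integral (\<Phi> s *\<^sub>R S s x)) {0..s}"
      by (rule has_integral_eq[rotated])
    then show ?thesis by (simp add: conv_op_def integral_unique)
  qed
  have "(\<integral>s. (exp (- \<omega> * s) * (\<Phi> s * norm (S s x))) powr p \<partial>lebesgue_on {0<..<T})
      = (\<integral>s. (exp (- \<omega> * s) * norm (conv_op S (cutoff T u) s)) powr p \<partial>lebesgue_on {0<..<T})"
    by (rule Bochner_Integration.integral_cong) (use \<Phi>_nonneg in \<open>auto simp: conv\<close>)
  also have "\<dots> \<le> conv_norm S \<omega> p powr p *
      (\<integral>s. (exp (- \<omega> * s) * norm (u s)) powr p \<partial>lebesgue_on {0<..<T})"
    by (rule conv_op_cutoff_estimate(3)[OF K p u])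
  finally show ?thesis by (simp add: u_def)
qed

text \<open>Testing \<open>\<Psi> S\<^sup>* y\<close> against \<open>c(s) u(s)\<close>, the scalar \<open>c\<close> being the one for which Hoelder's
  inequality is sharp; integration by parts moves the derivative to \<open>\<Psi>\<close> and produces the convolution
  of \<open>S\<close> with the reflected test function.\<close>

lemma dual_orbit_test:
  fixes y :: "'a \<Rightarrow> real" and u :: "real \<Rightarrow> 'a" and h \<Psi> \<Psi>' :: "real \<Rightarrow> real"
  assumes T: "T > 0" and y: "bounded_linear y"
    and \<Psi>: "\<And>s. s \<in> {0..T} \<Longrightarrow> (\<Psi> has_real_derivative \<Psi>' s) (at s within {0..T})"
    and \<Psi>': "continuous_on {0..T} \<Psi>'" and \<Psi>0: "\<Psi> 0 = 0" and \<Psi>_nonneg: "\<And>s. s \<ge> 0 \<Longrightarrow> \<Psi> s \<ge> 0"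
    and u: "continuous_on {0..T} u" "\<And>s. s \<in> {0..T} \<Longrightarrow> norm (u s) \<le> 1"
    and h: "h \<in> borel_measurable (lebesgue_on {0<..<T})"
      "\<And>s. s \<in> {0<..<T} \<Longrightarrow> 0 \<le> h s" "\<And>s. s \<in> {0<..<T} \<Longrightarrow> h s \<le> B"
      "\<And>s x. s \<in> {0<..<T} \<Longrightarrow> \<bar>y (S s x)\<bar> \<le> h s * norm x"
  shows "(\<integral>s. (exp (- \<omega> * s) * (\<Psi> s * max 0 (y (S s (u s))))) powr q \<partial>lebesgue_on {0<..<T})
    \<le> conv_norm S \<omega> p powr q *
      (\<integral>s. (exp (- \<omega> * s) * (\<bar>\<Psi>' s\<bar> * h s)) powr q \<partial>lebesgue_on {0<..<T})"
proof -
  let ?M = "lebesgue_on {0<..<T}"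
  define k where "k = (\<lambda>s. y (S s (u s)))"
  define a where "a = (\<lambda>s. exp (- \<omega> * s) * (\<Psi> s * max 0 (k s)))"
  \<comment> \<open>The extremal function for Hoelder: \<open>a s * d s\<close> and
    \<open>d s powr p\<close> both equal \<open>a s powr q\<close>.\<close>
  define d where "d = (\<lambda>s. a s powr (q - 1))"
  \<comment> \<open>The exponential cancels the weight exp (- \<omega> (T - s)) that the test
    function meets after reflection.\<close>
  define c where "c = (\<lambda>s. exp (\<omega> * (T - s)) * d s)"
  define f where "f = (\<lambda>s. c s * k s)"
  define U where "U = (\<lambda>r. c (T - r) *\<^sub>R u (T - r))"
  define v where "v = conv_op S (cutoff T U)"
  \<comment> \<open>The value \<open>P (T - s)\<close> is the integral of \<open>f\<close> over
    [s, T], so its derivative in s is \<open>- f s\<close>.\<close>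
  define P where "P = (\<lambda>r. integral {0..r} (\<lambda>\<tau>. f (T - \<tau>)))"
  define X where "X = (\<integral>s. a s powr q \<partial>?M)"
  define F where "F = (\<integral>s. (exp (- \<omega> * s) * (\<bar>\<Psi>' s\<bar> * h s)) powr q \<partial>?M)"
  define w where "w = (\<lambda>s. exp (- \<omega> * s) * norm (v s))"
  have \<Psi>c: "continuous_on {0..T} \<Psi>"
    using \<Psi> by (intro DERIV_continuous_on) auto
  have kc: "continuous_on {0..T} k"
    unfolding k_def
    by (intro bounded_linear.continuous_on[OF y] continuous_on_S u continuous_intros) auto
  have ac: "continuous_on {0..T} a"
    unfolding a_def by (intro continuous_intros \<Psi>c kc)
  have a0: "a s \<ge> 0" if "s \<in> {0..T}" for s using \<Psi>_nonneg[of s] that by (simp add: a_def)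
  have dc: "continuous_on {0..T} d"
    unfolding d_def using q a0 by (intro continuous_on_powr' ac continuous_intros) auto
  have cc: "continuous_on {0..T} c"
    unfolding c_def by (intro continuous_intros dc)
  have fc: "continuous_on {0..T} f"
    unfolding f_def by (intro continuous_intros cc kc)
  have refl_cont: "continuous_on {0..T} (\<lambda>r. g (T - r))" if "continuous_on {0..T} g"
    for g :: "real \<Rightarrow> 'c::topological_space"
    by (rule continuous_on_compose2[OF that]) (auto intro!: continuous_intros)
  have Uc: "continuous_on {0..T} U"
    unfolding U_def by (intro continuous_intros refl_cont cc u(1))
  note est = conv_op_cutoff_estimate[OF K p Uc, folded v_def, folded w_def]
  \<comment> \<open>Pulling \<open>y\<close> and \<open>S s\<close> into the convolution integral,
    with S s after S (T - s - r) equal to S (T - r), identifies the tail integral of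
    \<open>f\<close> as a pairing with the convolution.\<close>
  have v: "y (S s (v (T - s))) = P (T - s)" if s: "s \<in> {0..T}" for s
  proof -
    have bl: "bounded_linear (\<lambda>z. y (S s z))"
      using bounded_linear_compose[OF y S_linear[of s]] s by simp
    have "continuous_on {0..T - s} (\<lambda>r. S (T - s - r) (U r))"
      using s by (intro continuous_on_S continuous_intros continuous_on_subset[OF Uc]) auto
    then have "(\<lambda>r. S (T - s - r) (U r)) integrable_on {0..T - s}"
      by (rule integrable_continuous_interval)
    then have "integral {0..T - s} ((\<lambda>z. y (S s z)) \<circ> (\<lambda>r. S (T - s - r) (U r)))
        = y (S s (integral {0..T - s} (\<lambda>r. S (T - s - r) (U r))))"
      by (rule integral_linear[OF _ bl])
    moreover have "integral {0..T - s} (\<lambda>r. S (T - s - r) (U r)) = v (T - s)"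
      unfolding v_def conv_op_def using s by (intro integral_cong) (auto simp: cutoff_def)
    moreover have "integral {0..T - s} ((\<lambda>z. y (S s z)) \<circ> (\<lambda>r. S (T - s - r) (U r))) = P (T - s)"
      unfolding P_def
    proof (rule integral_cong)
      fix r assume r: "r \<in> {0..T - s}"
      have "S s (S (T - s - r) (U r)) = S (T - r) (U r)"
        using S_add[of s "T - s - r" "U r"] r s by simp
      also have "\<dots> = c (T - r) *\<^sub>R S (T - r) (u (T - r))"
        using linear_cmul[OF bounded_linear.linear[OF S_linear[of "T - r"]]] r s
        by (simp add: U_def)
      finally show "((\<lambda>z. y (S s z)) \<circ> (\<lambda>r. S (T - s - r) (U r))) r = f (T - r)"
        using linear_cmul[OF bounded_linear.linear[OF y]] by (simp add: f_def k_def)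
    qed
    ultimately show ?thesis by simp
  qed
  have P: "(P has_real_derivative f (T - r)) (at r within {0..T})" if "r \<in> {0..T}" for r
    unfolding P_def by (rule integral_has_real_derivative[OF refl_cont[OF fc] that])
  have G: "((\<lambda>s. P (T - s)) has_real_derivative - f s) (at s within {0..T})" if s: "s \<in> {0..T}" for s
  proof -
    have im: "(\<lambda>s. T - s) ` {0..T} = {0..T}" by force
    have "(P has_real_derivative f (T - (T - s))) (at (T - s) within (\<lambda>s. T - s) ` {0..T})"
      unfolding im using s by (intro P) auto
    moreover have "((\<lambda>s. T - s) has_real_derivative - 1) (at s within {0..T})"
      by (auto intro!: derivative_eq_intros)
    ultimately show ?thesis using DERIV_image_chain by (fastforce simp: o_def)
  qed
  have Gc: "continuous_on {0..T} (\<lambda>s. P (T - s))"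
    using G by (intro DERIV_continuous_on) auto
  \<comment> \<open>Both boundary terms vanish: \<Psi> is 0 at 0, and \<open>P (T - s)\<close> is 0
    at s = T.\<close>
  have parts: "(\<integral>s. \<Psi> s * f s \<partial>?M) = (\<integral>s. \<Psi>' s * P (T - s) \<partial>?M)"
  proof -
    have "((\<lambda>s. \<Psi>' s * P (T - s) - \<Psi> s * f s) has_integral (\<Psi> T * P (T - T) - \<Psi> 0 * P (T - 0))) {0..T}"
    proof (rule fundamental_theorem_of_calculus)
      fix s assume s: "s \<in> {0..T}"
      show "((\<lambda>s. \<Psi> s * P (T - s)) has_vector_derivative \<Psi>' s * P (T - s) - \<Psi> s * f s)
          (at s within {0..T})"
        unfolding has_real_derivative_iff_has_vector_derivative[symmetric]
        by (rule derivative_eq_intros \<Psi>[OF s] G[OF s] refl)+ simp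
    qed (use T in auto)
    moreover have "P 0 = 0" by (simp add: P_def)
    ultimately have "integral {0..T} (\<lambda>s. \<Psi>' s * P (T - s) - \<Psi> s * f s) = 0"
      by (simp add: \<Psi>0 integral_unique)
    moreover have "integral {0..T} (\<lambda>s. \<Psi>' s * P (T - s) - \<Psi> s * f s)
        = integral {0..T} (\<lambda>s. \<Psi>' s * P (T - s)) - integral {0..T} (\<lambda>s. \<Psi> s * f s)"
      by (intro Henstock_Kurzweil_Integration.integral_diff integrable_continuous_interval
          continuous_intros \<Psi>' Gc \<Psi>c fc)
    ultimately show ?thesis
      using continuous_integral_open_interval(2)[OF continuous_on_mult[OF \<Psi>' Gc]]
        continuous_integral_open_interval(2)[OF continuous_on_mult[OF \<Psi>c fc]] by simp
  qed
  have Xf: "X = exp (- \<omega> * T) * (\<integral>s. \<Psi> s * f s \<partial>?M)"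
  proof -
    have "X = (\<integral>s. exp (- \<omega> * T) * (\<Psi> s * f s) \<partial>?M)"
      unfolding X_def
    proof (rule Bochner_Integration.integral_cong)
      fix s assume s: "s \<in> space ?M"
      \<comment> \<open>Where \<open>k s\<close> is not positive, \<open>a s\<close> and hence
        \<open>d s\<close> vanish, so the truncation of \<open>k\<close> is harmless.\<close>
      have kd: "k s * d s = max 0 (k s) * d s"
        using q by (cases "k s \<le> 0") (auto simp: d_def a_def)
      have "exp (- \<omega> * T) * (\<Psi> s * f s) = exp (- \<omega> * T) * exp (\<omega> * (T - s)) * \<Psi> s * (k s * d s)"
        by (simp add: f_def c_def)
      also have "\<dots> = exp (- \<omega> * s) * \<Psi> s * (max 0 (k s) * d s)"
        unfolding kd by (simp add: exp_add[symmetric] algebra_simps)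
      also have "\<dots> = a s * d s" by (simp add: a_def)
      also have "\<dots> = a s powr q"
        unfolding d_def using a0[of s] s powr_mult_base[of "a s" "q - 1"] by simp
      finally show "a s powr q = exp (- \<omega> * T) * (\<Psi> s * f s)" by simp
    qed simp
    then show ?thesis by simp
  qed
  have \<Psi>'m: "\<Psi>' \<in> borel_measurable ?M"
    by (rule continuous_measurable_open_interval[OF \<Psi>'])
  obtain B' where B': "B' > 0" "\<And>s. s \<in> {0..T} \<Longrightarrow> \<bar>\<Psi>' s\<bar> \<le> B'"
    using continuous_bounded_on_Icc[OF \<Psi>'] by blast
  have ec: "continuous_on {0..T} (\<lambda>s. exp (- \<omega> * s))" by (intro continuous_intros)
  obtain B'' where B'': "B'' > 0" "\<And>s. s \<in> {0..T} \<Longrightarrow> \<bar>exp (- \<omega> * s)\<bar> \<le> B''"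
    using continuous_bounded_on_Icc[OF ec] by blast
  note em = continuous_measurable_open_interval[OF ec]
  \<comment> \<open>The absolute value of \<open>h\<close> makes \<open>g\<close> nonnegative
    everywhere and changes nothing on the open interval.\<close>
  define g where "g = (\<lambda>s. exp (- \<omega> * s) * (\<bar>\<Psi>' s\<bar> * \<bar>h s\<bar>))"
  have gm: "g \<in> borel_measurable ?M"
    unfolding g_def using em \<Psi>'m h(1) by measurable
  have gq: "integrable ?M (\<lambda>s. g s powr q)"
  proof (rule integrable_bounded_open_interval)
    show "(\<lambda>s. g s powr q) \<in> borel_measurable ?M" using gm by measurable
    fix s assume s: "s \<in> {0<..<T}"
    have "g s \<le> B'' * (B' * B)"
      unfolding g_def using B'(2)[of s] B''(2)[of s] B'(1) B''(1) h(2,3)[OF s] s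
      by (intro mult_mono) auto
    then show "\<bar>g s powr q\<bar> \<le> (B'' * (B' * B)) powr q"
      using q by (simp add: g_def powr_mono2)
  qed
  have gF: "(\<integral>s. g s powr q \<partial>?M) = F"
    unfolding F_def g_def by (rule Bochner_Integration.integral_cong) (use h(2) in auto)
  note wr = integral_reflection_open_interval[OF est(1)]
  have wpm: "(\<lambda>s. w s powr p) \<in> borel_measurable ?M" using est(1) by measurable
  note wpr = integral_reflection_open_interval[OF wpm]
  have hold: "integrable ?M (\<lambda>s. g s * w (T - s))"
    "(\<integral>s. g s * w (T - s) \<partial>?M) \<le> F powr (1 / q) * (\<integral>s. w s powr p \<partial>?M) powr (1 / p)"
    using Holder_inequality[of q p ?M g "\<lambda>s. w (T - s)"] q pq gm gq wr wpr est(2)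
    by (simp_all add: g_def[THEN fun_cong] w_def[THEN fun_cong] gF[symmetric] add.commute)
  have PG: "\<Psi>' s * P (T - s) \<le> exp (\<omega> * T) * (g s * w (T - s))" if s: "s \<in> {0<..<T}" for s
  proof -
    have "\<Psi>' s * P (T - s) \<le> \<bar>\<Psi>' s\<bar> * \<bar>y (S s (v (T - s)))\<bar>"
      using v[of s] s by (simp add: abs_mult[symmetric])
    also have "\<dots> \<le> \<bar>\<Psi>' s\<bar> * (\<bar>h s\<bar> * norm (v (T - s)))"
      using h(2)[OF s] h(4)[OF s, of "v (T - s)"] by (intro mult_left_mono) auto
    also have "\<dots> = exp (\<omega> * T) * (exp (- \<omega> * s) * exp (- \<omega> * (T - s))) *
        (\<bar>\<Psi>' s\<bar> * (\<bar>h s\<bar> * norm (v (T - s))))"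
      by (simp add: exp_add[symmetric] algebra_simps)
    also have "\<dots> = exp (\<omega> * T) * (g s * w (T - s))"
      by (simp add: g_def w_def)
    finally show ?thesis .
  qed
  \<comment> \<open>Reflection undoes the time reversal in \<open>U\<close>; since norm (u s) \<le>
    1 and \<open>d s powr p = a s powr q\<close>, the p-th power of the weighted norm of the test
    function is at most \<open>X\<close>.\<close>
  have wX: "(\<integral>s. w s powr p \<partial>?M) \<le> conv_norm S \<omega> p powr p * X"
  proof -
    have pq1: "(q - 1) * p = q"
      using pq p q by (simp add: field_simps)
    have dX: "d s powr p = a s powr q" for s by (simp add: d_def powr_powr pq1)
    define b where "b = (\<lambda>s. (exp (- \<omega> * (T - s)) * norm (c s *\<^sub>R u s)) powr p)"
    have bc: "continuous_on {0..T} b"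
      unfolding b_def using p by (intro continuous_on_powr' continuous_intros cc u(1)) auto
    have "(\<integral>s. (exp (- \<omega> * s) * norm (U s)) powr p \<partial>?M) = (\<integral>s. b (T - s) \<partial>?M)"
      by (simp add: b_def U_def)
    also have "\<dots> = (\<integral>s. b s \<partial>?M)"
      by (rule integral_reflection_open_interval(3)[OF continuous_measurable_open_interval[OF bc]])
    also have "\<dots> \<le> X"
      unfolding X_def
    proof (rule integral_mono)
      show "integrable ?M b" by (rule continuous_integral_open_interval(1)[OF bc])
      show "integrable ?M (\<lambda>s. a s powr q)"
        using q a0 by (intro continuous_integral_open_interval(1) continuous_on_powr' ac
            continuous_intros) auto
      fix s assume "s \<in> space ?M"
      then have s: "s \<in> {0..T}" by auto
      have "exp (- \<omega> * (T - s)) * norm (c s *\<^sub>R u s)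
          = (exp (- \<omega> * (T - s)) * exp (\<omega> * (T - s))) * d s * norm (u s)"
        by (simp add: c_def d_def abs_mult)
      also have "\<dots> = d s * norm (u s)" by (simp add: exp_add[symmetric])
      also have "\<dots> \<le> d s" using u(2)[OF s] by (simp add: d_def mult_left_le)
      finally have "b s \<le> d s powr p"
        unfolding b_def using p by (intro powr_mono2) auto
      then show "b s \<le> a s powr q" by (simp add: dX)
    qed
    finally show ?thesis
      unfolding w_def using est(3) by (meson mult_left_mono order_trans powr_ge_zero)
  qed
  have K0: "conv_norm S \<omega> p \<ge> 0" by (rule conv_norm_bound(1)[OF K])
  have X0: "X \<ge> 0" and F0: "F \<ge> 0"
    unfolding X_def F_def by (auto intro!: integral_nonneg_AE)
  have W0: "(\<integral>s. w s powr p \<partial>?M) \<ge> 0" by (auto intro!: integral_nonneg_AE)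
  have "X \<le> exp (- \<omega> * T) * (\<integral>s. exp (\<omega> * T) * (g s * w (T - s)) \<partial>?M)"
    unfolding Xf parts
    by (intro mult_left_mono integral_mono integrable_mult_right hold(1)
        continuous_integral_open_interval(1)[OF continuous_on_mult[OF \<Psi>' Gc]]) (use PG in auto)
  also have "\<dots> = (\<integral>s. g s * w (T - s) \<partial>?M)" by (simp add: exp_minus)
  also have "\<dots> \<le> F powr (1 / q) * (\<integral>s. w s powr p \<partial>?M) powr (1 / p)"
    by (rule hold(2))
  also have "\<dots> \<le> F powr (1 / q) * (conv_norm S \<omega> p powr p * X) powr (1 / p)"
    using wX W0 p by (intro mult_left_mono powr_mono2) auto
  also have "\<dots> = F powr (1 / q) * conv_norm S \<omega> p * X powr (1 / p)"
    using p K0 X0 by (simp add: powr_mult powr_powr)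
  finally have main: "X \<le> F powr (1 / q) * conv_norm S \<omega> p * X powr (1 / p)" .
  \<comment> \<open>For X > 0 the factor \<open>X powr (1 / p)\<close> cancels and leaves
    \<open>X powr (1 / q)\<close> on the left; the q-th power is the claim.\<close>
  have "X \<le> conv_norm S \<omega> p powr q * F"
  proof (cases "X = 0")
    case True
    then show ?thesis using F0 by simp
  next
    case False
    with X0 have Xp: "X > 0" by simp
    have "X powr (1 / q) * X powr (1 / p) = X"
      using pq Xp by (simp add: powr_add[symmetric] add.commute)
    with main Xp have "X powr (1 / q) \<le> F powr (1 / q) * conv_norm S \<omega> p"
      by (metis mult_le_cancel_right_pos powr_gt_zero less_numeral_extra(3))
    then have "(X powr (1 / q)) powr q \<le> (F powr (1 / q) * conv_norm S \<omega> p) powr q"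
      using q by (intro powr_mono2) auto
    then show ?thesis
      using q X0 F0 K0 by (simp add: powr_mult powr_powr mult.commute)
  qed
  then show ?thesis by (simp add: X_def F_def a_def k_def)
qed

text \<open>The norm of the functional obtained by composing y with S s, that is, of the adjoint
  orbit of y at time s. The unit ball is symmetric, so the absolute value can be left out.\<close>

definition dual_norm :: "('a \<Rightarrow> real) \<Rightarrow> real \<Rightarrow> real" where
  "dual_norm y s = (SUP x\<in>cball 0 1. y (S s x))"

lemma dual_norm:
  fixes y :: "'a \<Rightarrow> real"
  assumes y: "bounded_linear y" "\<And>x. \<bar>y x\<bar> \<le> norm x" and s: "s \<ge> 0"
  shows "bdd_above ((\<lambda>x. y (S s x)) ` cball 0 1)"
    and "0 \<le> dual_norm y s" and "dual_norm y s \<le> m s"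
    and "\<bar>y (S s x)\<bar> \<le> dual_norm y s * norm x"
proof -
  have yS: "y (S s x) \<le> m s" if "x \<in> cball 0 1" for x
  proof -
    have "y (S s x) \<le> norm (S s x)" using y(2)[of "S s x"] by simp
    also have "\<dots> \<le> m s * norm x" by (rule S_norm[OF s])
    also have "\<dots> \<le> m s" using that m_nonneg[OF s] by (simp add: mult_left_le)
    finally show ?thesis .
  qed
  then show bdd: "bdd_above ((\<lambda>x. y (S s x)) ` cball 0 1)" by (intro bdd_aboveI2)
  have lin: "linear (\<lambda>x. y (S s x))"
    using bounded_linear_compose[OF y(1) S_linear[OF s]] by (rule bounded_linear.linear)
  have le: "y (S s x) \<le> dual_norm y s" if "x \<in> cball 0 1" for x
    unfolding dual_norm_def by (rule cSUP_upper[OF that bdd])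
  show "0 \<le> dual_norm y s" using le[of 0] linear_0[OF lin] by simp
  show "dual_norm y s \<le> m s"
    unfolding dual_norm_def by (rule cSUP_least) (use yS in auto)
  have le': "y (S s z) \<le> dual_norm y s * norm z" for z
  proof (cases "z = 0")
    case True
    then show ?thesis using linear_0[OF lin] by simp
  next
    case False
    then have "y (S s ((1 / norm z) *\<^sub>R z)) \<le> dual_norm y s" by (intro le) simp
    then show ?thesis using False linear_cmul[OF lin, of "1 / norm z" z] by (simp add: field_simps)
  qed
  from le'[of x] le'[of "- x"] linear_neg[OF lin, of x]
  show "\<bar>y (S s x)\<bar> \<le> dual_norm y s * norm x" by (simp add: abs_le_iff)
qed

section \<open>Approximation of the dual norm and the dual estimate\<close>

lemma dual_norm_approximation:
  fixes y :: "'a \<Rightarrow> real"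
  assumes y: "bounded_linear y" "\<And>x. \<bar>y x\<bar> \<le> norm x"
  obtains u where "\<And>n::nat. continuous_on {0..T} (u n)"
    "\<And>n s. s \<in> {0..T} \<Longrightarrow> norm (u n s) \<le> 1"
    "\<And>n. continuous_on {0..T} (\<lambda>s. y (S s (u n s)))"
    "\<And>s. s \<in> {0..T} \<Longrightarrow> (\<lambda>n. y (S s (u n s))) \<longlonglongrightarrow> dual_norm y s"
proof (rule continuous_maximizing_selection[of "cball 0 1" "{0..T}" "\<lambda>s x. y (S s x)"])
  show "continuous_on {0..T} (\<lambda>s. y (S s x))" for x
    by (intro bounded_linear.continuous_on[OF y(1)] continuous_on_S continuous_intros) auto
  show "linear (\<lambda>x. y (S s x))" if "s \<in> {0..T}" for s
    using bounded_linear_compose[OF y(1) S_linear[of s]] that by (auto intro: bounded_linear.linear)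
  show "bdd_above ((\<lambda>x. y (S s x)) ` cball 0 1)" if "s \<in> {0..T}" for s
    using dual_norm(1)[OF y] that by auto
  fix u assume "\<And>n::nat. continuous_on {0..T} (u n)"
    "\<And>n s. s \<in> {0..T} \<Longrightarrow> u n s \<in> cball (0::'a) 1"
    "\<And>n. continuous_on {0..T} (\<lambda>s. y (S s (u n s)))"
    "\<And>s. s \<in> {0..T} \<Longrightarrow> (\<lambda>n. y (S s (u n s))) \<longlonglongrightarrow> (SUP x\<in>cball 0 1. y (S s x))"
  then show thesis by (intro that[of u]) (auto simp: dual_norm_def)
qed auto

lemma dual_norm_measurable:
  fixes y :: "'a \<Rightarrow> real"
  assumes y: "bounded_linear y" "\<And>x. \<bar>y x\<bar> \<le> norm x"
  shows "dual_norm y \<in> borel_measurable (lebesgue_on {0<..<T})"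
proof -
  obtain u where u: "\<And>n::nat. continuous_on {0..T} (u n)"
    "\<And>n s. s \<in> {0..T} \<Longrightarrow> norm (u n s) \<le> 1"
    "\<And>n. continuous_on {0..T} (\<lambda>s. y (S s (u n s)))"
    "\<And>s. s \<in> {0..T} \<Longrightarrow> (\<lambda>n. y (S s (u n s))) \<longlonglongrightarrow> dual_norm y s"
    using dual_norm_approximation[OF y] by blast
  show ?thesis
    by (rule borel_measurable_LIMSEQ_metric[where f = "\<lambda>n s. y (S s (u n s))",
          OF continuous_measurable_open_interval[OF u(3)]])
      (use u(4) in auto)
qed

text \<open>\<open>dual_orbit_test\<close> applies to each continuous selection with a right-hand
  side that does not depend on n. Dominated convergence, with \<Psi> m in place of the pairing as
  majorant, replaces the selection by the dual norm on the left.\<close>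

lemma dual_orbit_estimate:
  fixes y :: "'a \<Rightarrow> real" and \<Psi> \<Psi>' :: "real \<Rightarrow> real"
  assumes T: "T > 0" and y: "bounded_linear y" "\<And>x. \<bar>y x\<bar> \<le> norm x"
    and \<Psi>: "\<And>s. s \<in> {0..T} \<Longrightarrow> (\<Psi> has_real_derivative \<Psi>' s) (at s within {0..T})"
    and \<Psi>': "continuous_on {0..T} \<Psi>'" and \<Psi>0: "\<Psi> 0 = 0" and \<Psi>_nonneg: "\<And>s. s \<ge> 0 \<Longrightarrow> \<Psi> s \<ge> 0"
  shows "(\<integral>s. (exp (- \<omega> * s) * (\<Psi> s * dual_norm y s)) powr q \<partial>lebesgue_on {0<..<T})
    \<le> conv_norm S \<omega> p powr q *
      (\<integral>s. (exp (- \<omega> * s) * (\<bar>\<Psi>' s\<bar> * dual_norm y s)) powr q \<partial>lebesgue_on {0<..<T})"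
proof -
  let ?M = "lebesgue_on {0<..<T}"
  obtain u where u: "\<And>n::nat. continuous_on {0..T} (u n)"
    "\<And>n s. s \<in> {0..T} \<Longrightarrow> norm (u n s) \<le> 1"
    "\<And>n. continuous_on {0..T} (\<lambda>s. y (S s (u n s)))"
    "\<And>s. s \<in> {0..T} \<Longrightarrow> (\<lambda>n. y (S s (u n s))) \<longlonglongrightarrow> dual_norm y s"
    using dual_norm_approximation[OF y] by blast
  note hm = dual_norm_measurable[OF y, of T]
  have \<Psi>c: "continuous_on {0..T} \<Psi>"
    using \<Psi> by (intro DERIV_continuous_on) auto
  have mc: "continuous_on {0..T} m" by (rule continuous_on_subset[OF m_cont]) auto
  obtain B where B: "\<And>s. s \<in> {0..T} \<Longrightarrow> \<bar>m s\<bar> \<le> B"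
    using continuous_bounded_on_Icc[OF mc] by blast
  define a where "a = (\<lambda>n s. (exp (- \<omega> * s) * (\<Psi> s * max 0 (y (S s (u n s))))) powr q)"
  define b where "b = (\<lambda>s. (exp (- \<omega> * s) * (\<Psi> s * m s)) powr q)"
  have bc: "continuous_on {0..T} b"
    unfolding b_def using q \<Psi>_nonneg m_nonneg
    by (intro continuous_on_powr' continuous_intros \<Psi>c mc) auto
  have ac: "continuous_on {0..T} (a n)" for n
    unfolding a_def using q \<Psi>_nonneg
    by (intro continuous_on_powr' continuous_intros \<Psi>c u(3)) auto
  have lim: "(\<lambda>n. integral\<^sup>L ?M (a n))
      \<longlonglongrightarrow> (\<integral>s. (exp (- \<omega> * s) * (\<Psi> s * dual_norm y s)) powr q \<partial>?M)"
  proof (rule integral_dominated_convergence[where w = b])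
    have em: "(\<lambda>s. exp (- \<omega> * s)) \<in> borel_measurable ?M"
      by (intro continuous_measurable_open_interval continuous_intros)
    show "(\<lambda>s. (exp (- \<omega> * s) * (\<Psi> s * dual_norm y s)) powr q) \<in> borel_measurable ?M"
      using em hm continuous_measurable_open_interval[OF \<Psi>c] by measurable
    show "a n \<in> borel_measurable ?M" for n
      by (rule continuous_measurable_open_interval[OF ac])
    show "integrable ?M b" by (rule continuous_integral_open_interval(1)[OF bc])
    show "AE s in ?M. (\<lambda>n. a n s) \<longlonglongrightarrow> (exp (- \<omega> * s) * (\<Psi> s * dual_norm y s)) powr q"
    proof (rule AE_I2)
      fix s assume "s \<in> space ?M"
      then have s: "s \<in> {0..T}" by auto
      have "max 0 (dual_norm y s) = dual_norm y s" using dual_norm(2)[OF y, of s] s by simp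
      then have "(\<lambda>n. max 0 (y (S s (u n s)))) \<longlonglongrightarrow> dual_norm y s"
        using tendsto_max[OF tendsto_const u(4)[OF s], of 0] by simp
      then show "(\<lambda>n. a n s) \<longlonglongrightarrow> (exp (- \<omega> * s) * (\<Psi> s * dual_norm y s)) powr q"
        unfolding a_def using q s \<Psi>_nonneg[of s]
        by (intro tendsto_powr' tendsto_mult tendsto_const) (auto intro!: always_eventually)
    qed
    show "AE s in ?M. norm (a n s) \<le> b s" for n
    proof (rule AE_I2)
      fix s assume "s \<in> space ?M"
      then have s: "s \<in> {0..T}" by auto
      have "y (S s (u n s)) \<le> dual_norm y s"
        using dual_norm(4)[OF y, of s "u n s"] u(2)[OF s, of n] dual_norm(2)[OF y, of s] s
        by (auto simp: abs_le_iff intro: order_trans mult_left_le)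
      then have "max 0 (y (S s (u n s))) \<le> m s"
        using dual_norm(3)[OF y, of s] m_nonneg[of s] s by auto
      then show "norm (a n s) \<le> b s"
        unfolding a_def b_def using q \<Psi>_nonneg[of s] s
        by (simp add: powr_mono2 mult_left_mono)
    qed
  qed
  have "integral\<^sup>L ?M (a n) \<le> conv_norm S \<omega> p powr q *
      (\<integral>s. (exp (- \<omega> * s) * (\<bar>\<Psi>' s\<bar> * dual_norm y s)) powr q \<partial>?M)" for n
    unfolding a_def
  proof (rule dual_orbit_test[OF T y(1) \<Psi> \<Psi>' \<Psi>0 \<Psi>_nonneg u(1,2) hm])
    fix s assume s: "s \<in> {0<..<T}"
    show "0 \<le> dual_norm y s" using dual_norm(2)[OF y, of s] s by simp
    show "dual_norm y s \<le> B" using dual_norm(3)[OF y, of s] B[of s] s by simp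
    show "\<bar>y (S s x)\<bar> \<le> dual_norm y s * norm x" for x using dual_norm(4)[OF y, of s] s by simp
  qed
  then show ?thesis by (intro LIMSEQ_le_const2[OF lim]) auto
qed

end

section \<open>Defects\<close>

lemma pos_part_minus_neg_part: "pos_part x - neg_part x = x"
  by (simp add: pos_part_def neg_part_def)

text \<open>The pointwise identity \<open>(e \<Phi> H)\<^sup>p r\<^sup>p - (e \<bar>\<Phi>'\<bar> H)\<^sup>p = (pos_part D - neg_part D) (e H)\<^sup>p\<close> turns
  the hypothesis into a bound of the positive part by the negative part.\<close>

lemma defect_estimate:
  fixes \<Phi> \<Phi>' H m \<epsilon> :: "real \<Rightarrow> real"
  assumes p: "p > 1" and K: "K \<ge> 0" and c: "c \<ge> 0"
    and \<Phi>: "continuous_on {0..t} \<Phi>" "\<And>s. s \<in> {0..t} \<Longrightarrow> \<Phi> s \<ge> 0"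
    and \<Phi>': "continuous_on {0..t} \<Phi>'" "\<And>s. s \<in> {0<..<t} \<Longrightarrow> deriv \<Phi> s = \<Phi>' s"
    and m: "continuous_on {0..t} m" "\<And>s. s \<in> {0..t} \<Longrightarrow> m s \<ge> 0"
    and H: "H \<in> borel_measurable (lebesgue_on {0<..<t})"
      "\<And>s. s \<in> {0<..<t} \<Longrightarrow> 0 \<le> H s" "\<And>s. s \<in> {0<..<t} \<Longrightarrow> H s \<le> c * m s"
    and est: "(\<integral>s. (exp (- \<omega> * s) * (\<Phi> s * H s)) powr p \<partial>lebesgue_on {0<..<t})
      \<le> K powr p * (\<integral>s. (exp (- \<omega> * s) * (\<bar>\<Phi>' s\<bar> * H s)) powr p \<partial>lebesgue_on {0<..<t})"
    and \<epsilon>: "\<epsilon> \<in> {neg_part, pos_part}"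
  defines "f \<equiv> \<lambda>s. \<epsilon> (defect (1 / K) p \<Phi> s) powr (1 / p) * (exp (- \<omega> * s) * H s)"
  shows "f \<in> borel_measurable (lebesgue_on {0<..<t})"
    and "integrable (lebesgue_on {0<..<t}) (\<lambda>s. f s powr p)"
    and "(\<integral>s. f s powr p \<partial>lebesgue_on {0<..<t}) powr (1 / p)
      \<le> c * weighted_norm \<omega> p {0<..<t} (\<lambda>s. neg_part (defect (1 / K) p \<Phi> s) powr (1 / p) * m s)"
proof -
  let ?M = "lebesgue_on {0<..<t}"
  \<comment> \<open>This is the defect with \<Phi>' in place of \<open>deriv\<close>; it is
    continuous on the closed interval, while \<open>deriv\<close> is identified only inside.\<close>
  define D where "D = (\<lambda>s. (1 / K) powr p * \<Phi> s powr p - \<bar>\<Phi>' s\<bar> powr p)"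
  define E where "E = (\<lambda>s. (exp (- \<omega> * s) * H s) powr p)"
  define E' where "E' = (\<lambda>s. (exp (- \<omega> * s) * m s) powr p)"
  have D_eq: "defect (1 / K) p \<Phi> s = D s" if "s \<in> {0<..<t}" for s
    using \<Phi>'(2)[OF that] by (simp add: defect_def D_def)
  have \<Phi>p: "continuous_on {0..t} (\<lambda>s. \<Phi> s powr p)" "continuous_on {0..t} (\<lambda>s. \<bar>\<Phi>' s\<bar> powr p)"
    using p \<Phi>(2) by (intro continuous_on_powr' continuous_intros \<Phi>(1) \<Phi>'(1); auto)+
  have Dc: "continuous_on {0..t} D"
    unfolding D_def by (intro continuous_intros \<Phi>p)
  have pos0: "pos_part x \<ge> 0" and neg0: "neg_part x \<ge> 0" for x
    by (simp_all add: pos_part_def neg_part_def)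
  have \<epsilon>0: "\<epsilon> x \<ge> 0" for x using \<epsilon> pos0 neg0 by auto
  have part_cont: "continuous_on {0..t} (\<lambda>s. pos_part (D s))" "continuous_on {0..t} (\<lambda>s. neg_part (D s))"
    unfolding pos_part_def neg_part_def by (intro continuous_intros Dc)+
  have \<epsilon>c: "continuous_on {0..t} (\<lambda>s. \<epsilon> (D s))" using \<epsilon> part_cont by auto
  have ec: "continuous_on {0..t} (\<lambda>s. exp (- \<omega> * s))" by (intro continuous_intros)
  note em = continuous_measurable_open_interval[OF ec]
  have E'c: "continuous_on {0..t} E'"
    unfolding E'_def using p m by (intro continuous_on_powr' continuous_intros) auto
  have Em: "E \<in> borel_measurable ?M"
    unfolding E_def using em H(1) by measurable
  have EE': "E s \<le> c powr p * E' s" if s: "s \<in> {0<..<t}" for s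
  proof -
    have "E s \<le> (exp (- \<omega> * s) * (c * m s)) powr p"
      unfolding E_def using p H(2,3)[OF s] by (intro powr_mono2 mult_left_mono) auto
    also have "\<dots> = c powr p * E' s"
      using c m(2)[of s] s by (simp add: E'_def powr_mult)
    finally show ?thesis .
  qed
  have E0: "E s \<ge> 0" for s by (simp add: E_def)
  have int: "integrable ?M (\<lambda>s. g s * E s)" if g: "continuous_on {0..t} g" for g
  proof -
    have c': "continuous_on {0..t} (\<lambda>s. \<bar>g s\<bar> * (c powr p * E' s))"
      by (intro continuous_intros g E'c)
    show ?thesis
    proof (rule Bochner_Integration.integrable_bound[OF continuous_integral_open_interval(1)[OF c']])
      show "(\<lambda>s. g s * E s) \<in> borel_measurable ?M"
        using continuous_measurable_open_interval[OF g] Em by measurable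
      show "AE s in ?M. norm (g s * E s) \<le> norm (\<bar>g s\<bar> * (c powr p * E' s))"
        using EE' E0 by (intro AE_I2) (auto simp: abs_mult E'_def intro!: mult_left_mono)
    qed
  qed
  have f_eq: "f s = \<epsilon> (D s) powr (1 / p) * (exp (- \<omega> * s) * H s)" if "s \<in> {0<..<t}" for s
    by (simp add: f_def D_eq[OF that])
  have fp: "f s powr p = \<epsilon> (D s) * E s" if s: "s \<in> {0<..<t}" for s
    using p \<epsilon>0[of "D s"] H(2)[OF s] by (simp add: f_eq[OF s] E_def powr_mult powr_powr)
  have "continuous_on {0..t} (\<lambda>s. \<epsilon> (D s) powr (1 / p))"
    using p \<epsilon>0 by (intro continuous_on_powr' \<epsilon>c continuous_intros) auto
  then have "(\<lambda>s. \<epsilon> (D s) powr (1 / p) * (exp (- \<omega> * s) * H s)) \<in> borel_measurable ?M"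
    using continuous_measurable_open_interval em H(1) by (intro borel_measurable_times) auto
  then show "f \<in> borel_measurable ?M"
    by (rule measurable_cong[THEN iffD1, rotated]) (simp add: f_eq)
  show "integrable ?M (\<lambda>s. f s powr p)"
    using int[OF \<epsilon>c] by (rule Bochner_Integration.integrable_cong[THEN iffD1, rotated -1]) (auto simp: fp)
  have "(\<integral>s. D s * E s \<partial>?M) \<le> 0"
  proof -
    have a: "(\<integral>s. \<Phi> s powr p * E s \<partial>?M) = (\<integral>s. (exp (- \<omega> * s) * (\<Phi> s * H s)) powr p \<partial>?M)"
      by (rule Bochner_Integration.integral_cong)
        (use \<Phi>(2) H(2) in \<open>auto simp: E_def powr_mult mult_ac\<close>)
    have b: "(\<integral>s. \<bar>\<Phi>' s\<bar> powr p * E s \<partial>?M)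
        = (\<integral>s. (exp (- \<omega> * s) * (\<bar>\<Phi>' s\<bar> * H s)) powr p \<partial>?M)"
      by (rule Bochner_Integration.integral_cong) (use H(2) in \<open>auto simp: E_def powr_mult mult_ac\<close>)
    define J where "J = (\<integral>s. \<bar>\<Phi>' s\<bar> powr p * E s \<partial>?M)"
    have J0: "J \<ge> 0" unfolding J_def using E0 by (auto intro!: integral_nonneg_AE)
    have "(\<integral>s. D s * E s \<partial>?M)
        = (\<integral>s. (1 / K) powr p * (\<Phi> s powr p * E s) - \<bar>\<Phi>' s\<bar> powr p * E s \<partial>?M)"
      by (simp add: D_def algebra_simps)
    also have "\<dots> = (1 / K) powr p * (\<integral>s. \<Phi> s powr p * E s \<partial>?M) - J"
      using int[OF \<Phi>p(1)] int[OF \<Phi>p(2)] by (simp add: J_def)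
    also have "\<dots> \<le> (1 / K) powr p * (K powr p * J) - J"
      using est unfolding a b[symmetric] J_def by (intro diff_right_mono mult_left_mono) auto
    also have "\<dots> \<le> 0"
    \<comment> \<open>For K = 0 the quotient 1 / K is 0 by convention, and what remains is - J \<le>
      0.\<close>
    proof (cases "K = 0")
      case False
      then have "(1 / K) powr p * K powr p = 1" using K by (simp add: powr_mult[symmetric])
      then show ?thesis by (simp add: mult.assoc[symmetric])
    qed (use J0 in simp)
    finally show ?thesis .
  qed
  moreover have "(\<integral>s. D s * E s \<partial>?M)
      = (\<integral>s. pos_part (D s) * E s \<partial>?M) - (\<integral>s. neg_part (D s) * E s \<partial>?M)"
    using int[OF part_cont(1)] int[OF part_cont(2)]
    by (simp add: Bochner_Integration.integral_diff[symmetric] left_diff_distrib[symmetric]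
        pos_part_minus_neg_part)
  \<comment> \<open>For the negative part this is an equality; for the positive part it is the
    nonpositivity of the integral of \<open>D s * E s\<close>.\<close>
  ultimately have "(\<integral>s. \<epsilon> (D s) * E s \<partial>?M) \<le> (\<integral>s. neg_part (D s) * E s \<partial>?M)"
    using \<epsilon> by auto
  also have "\<dots> \<le> (\<integral>s. neg_part (D s) * (c powr p * E' s) \<partial>?M)"
  proof (rule integral_mono[OF int[OF part_cont(2)]])
    show "integrable ?M (\<lambda>s. neg_part (D s) * (c powr p * E' s))"
      by (intro continuous_integral_open_interval(1) continuous_intros part_cont E'c)
  qed (use EE' neg0 in \<open>auto intro!: mult_left_mono\<close>)
  also have "\<dots> = c powr p * (\<integral>s. neg_part (D s) * E' s \<partial>?M)"
    by (simp only: mult.left_commute[of _ "c powr p"] integral_mult_right_zero)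
  finally have "(\<integral>s. \<epsilon> (D s) * E s \<partial>?M) \<le> c powr p * (\<integral>s. neg_part (D s) * E' s \<partial>?M)" .
  moreover have "(\<integral>s. f s powr p \<partial>?M) = (\<integral>s. \<epsilon> (D s) * E s \<partial>?M)"
    by (rule Bochner_Integration.integral_cong) (auto simp: fp)
  ultimately have le: "(\<integral>s. f s powr p \<partial>?M) \<le> c powr p * (\<integral>s. neg_part (D s) * E' s \<partial>?M)"
    by simp
  have I0: "(\<integral>s. neg_part (D s) * E' s \<partial>?M) \<ge> 0" "(\<integral>s. f s powr p \<partial>?M) \<ge> 0"
    using neg0 by (auto intro!: integral_nonneg_AE simp: E'_def)
  have "(\<integral>s. neg_part (D s) * E' s \<partial>?M)
      = (\<integral>s. (exp (- \<omega> * s) * norm (neg_part (defect (1 / K) p \<Phi> s) powr (1 / p) * m s)) powr p \<partial>?M)"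
  proof (rule Bochner_Integration.integral_cong)
    fix s assume "s \<in> space ?M"
    then have s: "s \<in> {0<..<t}" by auto
    have "(exp (- \<omega> * s) * norm (neg_part (defect (1 / K) p \<Phi> s) powr (1 / p) * m s)) powr p
        = (neg_part (D s) powr (1 / p) * (exp (- \<omega> * s) * m s)) powr p"
      using m(2)[of s] s by (simp add: D_eq[OF s] abs_mult mult_ac)
    also have "\<dots> = neg_part (D s) * E' s"
      using p neg0 m(2)[of s] s by (simp add: E'_def powr_mult powr_powr)
    finally show "neg_part (D s) * E' s
        = (exp (- \<omega> * s) * norm (neg_part (defect (1 / K) p \<Phi> s) powr (1 / p) * m s)) powr p" by simp
  qed simp
  then have wn: "weighted_norm \<omega> p {0<..<t} (\<lambda>s. neg_part (defect (1 / K) p \<Phi> s) powr (1 / p) * m s)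
      = (\<integral>s. neg_part (D s) * E' s \<partial>?M) powr (1 / p)"
    by (simp add: weighted_norm_lebesgue_on)
  have "(\<integral>s. f s powr p \<partial>?M) powr (1 / p)
      \<le> (c powr p * (\<integral>s. neg_part (D s) * E' s \<partial>?M)) powr (1 / p)"
    using le I0 p by (intro powr_mono2) auto
  then show "(\<integral>s. f s powr p \<partial>?M) powr (1 / p)
      \<le> c * weighted_norm \<omega> p {0<..<t} (\<lambda>s. neg_part (defect (1 / K) p \<Phi> s) powr (1 / p) * m s)"
    unfolding wn using c p I0 by (simp add: powr_mult powr_powr)
qed

section \<open>Derivatives of the weight functions and reflection of the defect\<close>

lemma C1_nonneg_derivative:
  assumes "C1_nonneg f" and T: "T \<ge> 0"
  obtains f' where "continuous_on {0..T} f'"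
    "\<And>s. s \<in> {0..T} \<Longrightarrow> (f has_real_derivative f' s) (at s within {0..T})"
    "\<And>s. s > 0 \<Longrightarrow> (f has_real_derivative f' s) (at s)"
proof -
  obtain f' where f': "continuous_on {0..} f'"
      "\<And>s. s \<ge> 0 \<Longrightarrow> (f has_real_derivative f' s) (at s within {0..})"
    using assms by (auto simp: C1_nonneg_def)
  show ?thesis
  proof
    show "continuous_on {0..T} f'" by (rule continuous_on_subset[OF f'(1)]) auto
    show "(f has_real_derivative f' s) (at s within {0..T})" if "s \<in> {0..T}" for s
      by (rule DERIV_subset[OF f'(2)]) (use that in auto)
    show "(f has_real_derivative f' s) (at s)" if "s > 0" for s
      using f'(2)[of s] that at_within_interior[of s "{0..}"] by simp
  qed
qed

text \<open>Reflection changes only the sign of the derivative, which the absolute value removes. In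
  the denominator the reflection thus moves from \<Psi> to the argument of the whole weight.\<close>

lemma defect_reflect:
  assumes "(f has_real_derivative f') (at (t - s))"
  shows "defect r p (reflect t f) s = defect r p f (t - s)"
proof -
  have "((\<lambda>s. f (t - s)) has_real_derivative f' * (0 - 1)) (at s)"
    by (rule DERIV_chain2[where f = f and g = "\<lambda>s. t - s", OF assms]) (auto intro!: derivative_eq_intros)
  then have "deriv (reflect t f) s = - f'"
    unfolding reflect_def[abs_def] by (intro DERIV_imp_deriv) simp
  with DERIV_imp_deriv[OF assms] show ?thesis
    by (simp add: defect_def reflect_def)
qed

section \<open>Combination of the orbit and dual orbit estimates\<close>

theorem theorem1p3:
  fixes S :: "real \<Rightarrow> 'a::complex_banach \<Rightarrow> 'a"
    and \<omega> p q t :: real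
    and m \<Phi> \<Psi> :: "real \<Rightarrow> real"
    and \<epsilon>\<^sub>1 \<epsilon>\<^sub>2 :: "real \<Rightarrow> real"
  assumes "(UNIV :: 'a set) \<noteq> {0}"
    and "reflexive_space TYPE('a)"
    and "C0_semigroup S"
    and "p > 1" and "1 / p + 1 / q = 1"
    and "conv_bounded S \<omega> p"
    and "continuous_on {0..} m"
    and "\<And>s. s \<ge> 0 \<Longrightarrow> m s > 0"
    and "\<And>s. s \<ge> 0 \<Longrightarrow> onorm (S s) \<le> m s"
    and "C1_nonneg \<Phi>" and "C1_nonneg \<Psi>"
    and "\<Phi> 0 = 0" and "\<Psi> 0 = 0"
    and "\<And>s. s > 0 \<Longrightarrow> \<Phi> s > 0"
    and "\<And>s. s > 0 \<Longrightarrow> \<Psi> s > 0"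
    and "\<epsilon>\<^sub>1 \<in> {neg_part, pos_part}" and "\<epsilon>\<^sub>2 \<in> {neg_part, pos_part}"
    and "t > 0"
    and "(LINT s:{0<..<t}|lebesgue.
            \<epsilon>\<^sub>1 (defect (r_hat S \<omega> p) p \<Phi> s) powr (1 / p) *
            \<epsilon>\<^sub>2 (defect (r_hat S \<omega> p) q (reflect t \<Psi>) s) powr (1 / q)) \<noteq> 0"
  shows "onorm (S t) \<le> exp (\<omega> * t) *
     (weighted_norm \<omega> p {0<..<t}
        (\<lambda>s. neg_part (defect (r_hat S \<omega> p) p \<Phi> s) powr (1 / p) * m s) *
      weighted_norm \<omega> q {0<..<t}
        (\<lambda>s. neg_part (defect (r_hat S \<omega> p) q \<Psi> s) powr (1 / q) * m s)) /
     (LINT s:{0<..<t}|lebesgue.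
        \<epsilon>\<^sub>1 (defect (r_hat S \<omega> p) p \<Phi> s) powr (1 / p) *
        \<epsilon>\<^sub>2 (defect (r_hat S \<omega> p) q (reflect t \<Psi>) s) powr (1 / q))"
proof -
  interpret convolution_bounded_semigroup S \<omega> p q m
    by (rule convolution_bounded_semigroup.intro[OF assms(3-7,9)])
  let ?M = "lebesgue_on {0<..<t}"
  define K where "K = conv_norm S \<omega> p"
  define N\<^sub>1 where "N\<^sub>1 = weighted_norm \<omega> p {0<..<t}
        (\<lambda>s. neg_part (defect (1 / K) p \<Phi> s) powr (1 / p) * m s)"
  define N\<^sub>2 where "N\<^sub>2 = weighted_norm \<omega> q {0<..<t}
        (\<lambda>s. neg_part (defect (1 / K) q \<Psi> s) powr (1 / q) * m s)"
  define w\<^sub>1 where "w\<^sub>1 = (\<lambda>s. \<epsilon>\<^sub>1 (defect (1 / K) p \<Phi> s) powr (1 / p))"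
  define w\<^sub>2 where "w\<^sub>2 = (\<lambda>s. \<epsilon>\<^sub>2 (defect (1 / K) q \<Psi> s) powr (1 / q))"
  define J where "J = (\<integral>s. w\<^sub>1 s * w\<^sub>2 (t - s) \<partial>?M)"
  have t: "t > 0" by fact
  have K0: "K \<ge> 0" unfolding K_def by (rule conv_norm_bound(1)[OF K])
  obtain \<Phi>' where \<Phi>': "continuous_on {0..t} \<Phi>'"
    "\<And>s. s \<in> {0..t} \<Longrightarrow> (\<Phi> has_real_derivative \<Phi>' s) (at s within {0..t})"
    "\<And>s. s > 0 \<Longrightarrow> (\<Phi> has_real_derivative \<Phi>' s) (at s)"
    using C1_nonneg_derivative[OF \<open>C1_nonneg \<Phi>\<close>, of t] t by auto
  obtain \<Psi>' where \<Psi>': "continuous_on {0..t} \<Psi>'"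
    "\<And>s. s \<in> {0..t} \<Longrightarrow> (\<Psi> has_real_derivative \<Psi>' s) (at s within {0..t})"
    "\<And>s. s > 0 \<Longrightarrow> (\<Psi> has_real_derivative \<Psi>' s) (at s)"
    using C1_nonneg_derivative[OF \<open>C1_nonneg \<Psi>\<close>, of t] t by auto
  have nonneg: "\<Phi> s \<ge> 0" "\<Psi> s \<ge> 0" if "s \<ge> 0" for s
    using assms(12,13) assms(14,15)[of s] that by (cases "s = 0"; simp)+
  have cont: "continuous_on {0..t} \<Phi>" "continuous_on {0..t} \<Psi>" "continuous_on {0..t} m"
    by (rule DERIV_continuous_on[OF \<Phi>'(2)] DERIV_continuous_on[OF \<Psi>'(2)]
        continuous_on_subset[OF m_cont]; simp)+
  have J_eq: "(LINT s:{0<..<t}|lebesgue.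
      \<epsilon>\<^sub>1 (defect (r_hat S \<omega> p) p \<Phi> s) powr (1 / p) *
      \<epsilon>\<^sub>2 (defect (r_hat S \<omega> p) q (reflect t \<Psi>) s) powr (1 / q)) = J"
  proof -
    have "J = (\<integral>s. \<epsilon>\<^sub>1 (defect (r_hat S \<omega> p) p \<Phi> s) powr (1 / p) *
        \<epsilon>\<^sub>2 (defect (r_hat S \<omega> p) q (reflect t \<Psi>) s) powr (1 / q) \<partial>?M)"
      unfolding J_def
      by (rule Bochner_Integration.integral_cong)
        (auto simp: w\<^sub>1_def w\<^sub>2_def r_hat_def K_def defect_reflect[OF \<Psi>'(3)])
    then show ?thesis by (simp add: integral_restrict_space set_lebesgue_integral_def)
  qed
  have "J \<noteq> 0" using assms(19) unfolding J_eq .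
  \<comment> \<open>A function that is not integrable has integral 0 by convention, so the nonzero
    denominator yields integrability.\<close>
  then have J_int: "integrable ?M (\<lambda>s. w\<^sub>1 s * w\<^sub>2 (t - s))"
    unfolding J_def by (metis not_integrable_integral_eq)
  have "J \<ge> 0" unfolding J_def by (auto intro!: integral_nonneg_AE simp: w\<^sub>1_def w\<^sub>2_def)
  with \<open>J \<noteq> 0\<close> have J: "J > 0" by simp
  have N0: "N\<^sub>1 \<ge> 0" "N\<^sub>2 \<ge> 0" by (simp_all add: N\<^sub>1_def N\<^sub>2_def weighted_norm_def)
  have main: "exp (- \<omega> * t) * norm (S t x) * J \<le> norm x * N\<^sub>1 * N\<^sub>2" for x
  proof -
    \<comment> \<open>The functional is chosen for the single vector \<open>S t x\<close>; the dual
      orbit therefore depends on \<open>x\<close>, but its bound \<open>N\<^sub>2\<close> does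
      not.\<close>
    obtain y :: "'a \<Rightarrow> real" where y: "bounded_linear y" "\<And>z. \<bar>y z\<bar> \<le> norm z"
      and y_norm: "y (S t x) = norm (S t x)"
      using exists_norming_functional by blast
    define f where "f = (\<lambda>s. w\<^sub>1 s * (exp (- \<omega> * s) * norm (S s x)))"
    define g where "g = (\<lambda>s. w\<^sub>2 s * (exp (- \<omega> * s) * dual_norm y s))"
    have Sc: "continuous_on {0..t} (\<lambda>s. norm (S s x))"
      by (intro continuous_intros continuous_on_subset[OF S_cont]) auto
    have SH: "norm (S s x) \<le> norm x * m s" if "s \<in> {0<..<t}" for s
      using S_norm[of s x] that by (simp add: mult.commute)
    have yH: "dual_norm y s \<le> 1 * m s" if "s \<in> {0<..<t}" for s
      using dual_norm(3)[OF y, of s] that by simp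
    have D: "deriv \<Phi> s = \<Phi>' s" "deriv \<Psi> s = \<Psi>' s" if "s \<in> {0<..<t}" for s
      using that by (auto intro!: DERIV_imp_deriv \<Phi>'(3) \<Psi>'(3))
    note Sm = continuous_measurable_open_interval[OF Sc]
    have f: "f \<in> borel_measurable ?M" "integrable ?M (\<lambda>s. f s powr p)"
      "(\<integral>s. f s powr p \<partial>?M) powr (1 / p) \<le> norm x * N\<^sub>1"
    proof -
      \<comment> \<open>The constant in front of \<open>m\<close> is \<open>norm x\<close> for the
        orbit; for the dual orbit below it is 1.\<close>
      note e = defect_estimate[OF p K0 norm_ge_zero cont(1) nonneg(1) \<Phi>'(1) D(1) cont(3) m_nonneg Sm
          norm_ge_zero SH orbit_estimate[OF \<Phi>'(2,1) \<open>\<Phi> 0 = 0\<close> nonneg(1), folded K_def] assms(16)]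
      show "f \<in> borel_measurable ?M" "integrable ?M (\<lambda>s. f s powr p)"
          "(\<integral>s. f s powr p \<partial>?M) powr (1 / p) \<le> norm x * N\<^sub>1"
        unfolding f_def w\<^sub>1_def N\<^sub>1_def by (rule e; simp)+
    qed
    have g: "g \<in> borel_measurable ?M" "integrable ?M (\<lambda>s. g s powr q)"
      "(\<integral>s. g s powr q \<partial>?M) powr (1 / q) \<le> 1 * N\<^sub>2"
    proof -
      note e = defect_estimate[OF q K0 zero_le_one cont(2) nonneg(2) \<Psi>'(1) D(2) cont(3) m_nonneg
          dual_norm_measurable[OF y] dual_norm(2)[OF y] yH
          dual_orbit_estimate[OF t y \<Psi>'(2,1) \<open>\<Psi> 0 = 0\<close> nonneg(2), folded K_def] assms(17)]
      show "g \<in> borel_measurable ?M" "integrable ?M (\<lambda>s. g s powr q)"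
          "(\<integral>s. g s powr q \<partial>?M) powr (1 / q) \<le> 1 * N\<^sub>2"
        unfolding g_def w\<^sub>2_def N\<^sub>2_def by (rule e; simp)+
    qed
    note gr = integral_reflection_open_interval[OF g(1)]
    have gqm: "(\<lambda>s. g s powr q) \<in> borel_measurable ?M" using g(1) by measurable
    note gqr = integral_reflection_open_interval[OF gqm]
    have f0: "f s \<ge> 0" for s by (simp add: f_def w\<^sub>1_def)
    have g0: "g (t - s) \<ge> 0" if "s \<in> space ?M" for s
      using dual_norm(2)[OF y, of "t - s"] that by (simp add: g_def w\<^sub>2_def)
    have gq': "integrable ?M (\<lambda>s. g (t - s) powr q)" using gqr(2) g(2) by simp
    note hold = Holder_inequality[OF p pq f0 g0 f(1) gr(1) f(2) gq']
    have "exp (- \<omega> * t) * norm (S t x) * J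
        = (\<integral>s. exp (- \<omega> * t) * norm (S t x) * (w\<^sub>1 s * w\<^sub>2 (t - s)) \<partial>?M)"
      by (simp add: J_def)
    also have "\<dots> \<le> (\<integral>s. f s * g (t - s) \<partial>?M)"
    proof (rule integral_mono)
      show "integrable ?M (\<lambda>s. exp (- \<omega> * t) * norm (S t x) * (w\<^sub>1 s * w\<^sub>2 (t - s)))"
        using J_int by (rule integrable_mult_right)
      show "integrable ?M (\<lambda>s. f s * g (t - s))" by (rule hold(1))
      fix s assume "s \<in> space ?M"
      then have s: "0 < s" "s < t" by auto
      have "norm (S t x) = y (S (t - s) (S s x))"
        using S_add[of "t - s" s x] s y_norm by simp
      also have "\<dots> \<le> dual_norm y (t - s) * norm (S s x)"
        using dual_norm(4)[OF y, of "t - s" "S s x"] s by simp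
      finally have le: "norm (S t x) \<le> dual_norm y (t - s) * norm (S s x)" .
      \<comment> \<open>The weight at time t is the product of the weights at s and t - s, one for
        each Hoelder factor.\<close>
      have "exp (- \<omega> * t) * norm (S t x) * (w\<^sub>1 s * w\<^sub>2 (t - s))
          = (exp (- \<omega> * s) * exp (- \<omega> * (t - s))) * (w\<^sub>1 s * w\<^sub>2 (t - s)) * norm (S t x)"
        by (simp add: exp_add[symmetric] algebra_simps)
      also have "\<dots> \<le> (exp (- \<omega> * s) * exp (- \<omega> * (t - s))) * (w\<^sub>1 s * w\<^sub>2 (t - s)) *
          (dual_norm y (t - s) * norm (S s x))"
        using le by (intro mult_left_mono) (auto simp: w\<^sub>1_def w\<^sub>2_def)
      also have "\<dots> = f s * g (t - s)" by (simp add: f_def g_def)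
      finally show "exp (- \<omega> * t) * norm (S t x) * (w\<^sub>1 s * w\<^sub>2 (t - s)) \<le> f s * g (t - s)" .
    qed
    also have "\<dots> \<le> (\<integral>s. f s powr p \<partial>?M) powr (1 / p) * (\<integral>s. g s powr q \<partial>?M) powr (1 / q)"
      using hold(2) unfolding gqr(3) .
    also have "\<dots> \<le> (norm x * N\<^sub>1) * (1 * N\<^sub>2)"
      using f(3) g(3) N0 by (intro mult_mono) auto
    finally show ?thesis by simp
  qed
  have "onorm (S t) \<le> exp (\<omega> * t) * (N\<^sub>1 * N\<^sub>2) / J"
  proof (rule onorm_bound)
    show "0 \<le> exp (\<omega> * t) * (N\<^sub>1 * N\<^sub>2) / J" using J N0 by simp
    fix x
    have "norm (S t x) * J = exp (\<omega> * t) * (exp (- \<omega> * t) * norm (S t x) * J)"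
      by (simp add: exp_minus)
    also have "\<dots> \<le> exp (\<omega> * t) * (norm x * N\<^sub>1 * N\<^sub>2)"
      using main[of x] by (intro mult_left_mono) auto
    finally show "norm (S t x) \<le> exp (\<omega> * t) * (N\<^sub>1 * N\<^sub>2) / J * norm x"
      using J by (simp add: field_simps)
  qed
  then show ?thesis
    unfolding J_eq by (simp add: N\<^sub>1_def N\<^sub>2_def K_def r_hat_def)
qed

end
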